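(* Let $\mathscr{L}(w)=\frac1n\sum_{i=1}^n \ell_i(w)$, $w\in\mathbb{R}^d$, where each $\ell_i$ is continuously differentiable, and suppose that $\mathscr{L}$ is $L$-Lipschitz smooth for some $L>0$, i.e. $\|\nabla\mathscr{L}(u)-\nabla\mathscr{L}(v)\|\le L\|u-v\|$ for all $u,v\in\mathbb{R}^d$. Let $\alpha>0$ and let $(w_k)_{k\ge1}$ be the Adam iterates generated by $$m_k=\beta_1 m_{k-1}+(1-\beta_1)g_k,\qquad v_k=\beta_2 v_{k-1}+(1-\beta_2)g_k^2,\qquad w_{k+1}=w_k-\alpha\, m_k\odot v_k^{-1/2}\qquad(k\ge1),$$ with $m_0=0\in\mathbb{R}^d$ and $v_0\in(0,\infty)^d$, where $g_k=\nabla\mathscr{L}_{\mathcal{B}_k}(w_k)$ is the batch gradient on the random batch $\mathcal{B}_k$, and where the batch size $b_k=|\mathcal{B}_k|$ is chosen such that the coordinate-wise (exact variance) norm test with constant $\eta\in(0,1)$ is satisfied at each iteration $k\ge1$, i.e. $$\mathbb{E}_k\big[(\partial_i\mathscr{L}_{\mathcal{B}_k}(w_k)-\partial_i\mathscr{L}(w_k))^2\big]\le\eta^2(\partial_i\mathscr{L}(w_k))^2\qquad\text{for all } i\in\{1,\dots,d\}.$$ Then, if $$0<\beta_1\le\sqrt{\beta_2}-\frac{8(1+\eta^2)(1-\beta_2)}{\beta_2^2}\qquad\text{and}\qquad \beta_2\in(0,1),$$ we have $$\sum_{k=1}^K\mathbb{E}\big[\|\nabla\mathscr{L}(w_k)\|\big]\le\tilde{\mathcal{O}}(K),$$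 where $\tilde{\mathcal{O}}$ hides any logarithmic factors.
   Context: $\|\cdot\|$ is the Euclidean norm on $\mathbb{R}^d$; $\partial_i$ is the partial derivative in the $i$-th coordinate; $\odot$ is the coordinate-wise (Hadamard) product, and powers of vectors ($g_k^2$, $v_k^{-1/2}$) are taken coordinate-wise. $\ell_i(w)=\ell(w;z_i)$ is the loss of the $i$-th of $n$ training samples. A batch $\mathcal{B}_k\subseteq\{1,\dots,n\}$ is a subset of indices sampled uniformly without replacement, of size $b_k=|\mathcal{B}_k|$; the batch gradient is $\nabla\mathscr{L}_{\mathcal{B}_k}(w)=\frac{1}{b_k}\sum_{i\in\mathcal{B}_k}\nabla\ell_i(w)$, with $i$-th coordinate $\partial_i\mathscr{L}_{\mathcal{B}_k}(w)$. $\mathcal{F}_k$ is the $\sigma$-algebra generated by the initial point and the batches drawn before iteration $k$, and $\mathbb{E}_k[\cdot]=\mathbb{E}[\cdot\mid\mathcal{F}_k]$. The bound $\tilde{\mathcal{O}}(K)$ is for growing $K$, up to factors logarithmic in $K$, with all other quantities ($L,d,\alpha,\beta_1,\beta_2,\eta$, the initial data, and the function) fixed.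
   Formalization: The objective 𝓛 is additionally assumed to be bounded below; without this the claim fails, e.g. for d=n=1, ℓ(w)=−w²/2, w_1=v_0=1 with full batches, where the sum of gradient norms grows like K². *)

theory Defs
  imports "HOL-Probability.Probability" "HOL-Library.Landau_Symbols"
begin

definition partial :: "'d::finite \<Rightarrow> (real^'d \<Rightarrow> real) \<Rightarrow> real^'d \<Rightarrow> real" where
  "partial i f x = deriv (\<lambda>t. f (x + t *\<^sub>R axis i 1)) 0"

definition grad :: "(real^'d::finite \<Rightarrow> real) \<Rightarrow> real^'d \<Rightarrow> real^'d" where
  "grad f x = (\<chi> i. partial i f x)"

lemma GDERIV_grad:
  fixes f :: "real^'d::finite \<Rightarrow> real"
  assumes "f differentiable (at x)"
  shows "GDERIV f x :> grad f x"
proof -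
  from assms obtain f' where f': "(f has_derivative f') (at x)"
    unfolding differentiable_def by blast
  then have lin: "linear f'"
    by (rule has_derivative_linear)
  have part: "partial i f x = f' (axis i 1)" for i
  proof -
    have "((\<lambda>t. x + t *\<^sub>R axis i 1) has_derivative (\<lambda>t. t *\<^sub>R axis i 1)) (at (0::real))"
      by (auto intro!: derivative_eq_intros)
    moreover have "(f has_derivative f') (at (x + 0 *\<^sub>R axis i 1))"
      using f' by simp
    ultimately have "((\<lambda>t. f (x + t *\<^sub>R axis i 1)) has_derivative (\<lambda>t. f' (t *\<^sub>R axis i 1))) (at 0)"
      by (rule has_derivative_compose)
    moreover have "(\<lambda>t. f' (t *\<^sub>R axis i 1)) = (*) (f' (axis i 1))"
      by (rule ext) (subst linear_scale[OF lin], simp)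
    ultimately have "((\<lambda>t. f (x + t *\<^sub>R axis i 1)) has_field_derivative f' (axis i 1)) (at 0)"
      unfolding has_field_derivative_def by (rule back_subst)
    then show ?thesis
      unfolding partial_def by (rule DERIV_imp_deriv)
  qed
  have "f' = (\<lambda>h. inner h (grad f x))"
  proof
    fix h
    have "f' h = f' (\<Sum>i\<in>UNIV. (h $ i) *\<^sub>R axis i 1)"
      using basis_expansion[of h] by (simp only: scalar_mult_eq_scaleR)
    also have "\<dots> = inner h (grad f x)"
      unfolding linear_sum[OF lin] linear_scale[OF lin] inner_vec_def grad_def part
      by simp
    finally show "f' h = inner h (grad f x)" .
  qed
  then show ?thesis
    using f' by (simp only: gderiv_def)
qed

definition continuously_differentiable :: "(real^'d::finite \<Rightarrow> real) \<Rightarrow> bool" where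
  "continuously_differentiable f \<longleftrightarrow>
     (\<forall>x. f differentiable (at x)) \<and> continuous_on UNIV (grad f)"

definition risk :: "nat \<Rightarrow> (nat \<Rightarrow> real^'d::finite \<Rightarrow> real) \<Rightarrow> real^'d \<Rightarrow> real" where
  "risk n l w = (1 / real n) * (\<Sum>i=1..n. l i w)"

definition batch_grad :: "(nat \<Rightarrow> real^'d::finite \<Rightarrow> real) \<Rightarrow> nat set \<Rightarrow> real^'d \<Rightarrow> real^'d" where
  "batch_grad l S w = (1 / real (card S)) *\<^sub>R (\<Sum>i\<in>S. grad (l i) w)"

definition batches :: "nat \<Rightarrow> nat set set" where
  "batches n = {S. S \<subseteq> {1..n} \<and> S \<noteq> {}}"

text \<open>The \<open>\<sigma>\<close>-algebra generated by the initial point and the batches with index \<open>1 \<le> j < k\<close>.\<close>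

definition history :: "'a measure \<Rightarrow> ('a \<Rightarrow> real^'d::finite) \<Rightarrow> (nat \<Rightarrow> 'a \<Rightarrow> nat set) \<Rightarrow> nat \<Rightarrow> 'a measure" where
  "history M w1 B k = sigma (space M)
     ({w1 -` A \<inter> space M |A. A \<in> sets borel} \<union> {B j -` A \<inter> space M |A j. 1 \<le> j \<and> j < k})"

text \<open>
  Uniform sampling without replacement, where the size \<open>card (B k)\<close> may be random and may depend
  on the past: \<open>P(B k = S | F k) = P(card (B k) = card S | F k) / (n choose card S)\<close>.  If the size
  is measurable with respect to \<open>F k\<close>, the numerator is the indicator of \<open>card (B k) = card S\<close>.
\<close>

definition uniform_batch_sampling ::
  "'a measure \<Rightarrow> nat \<Rightarrow> ('a \<Rightarrow> real^'d::finite) \<Rightarrow> (nat \<Rightarrow> 'a \<Rightarrow> nat set) \<Rightarrow> bool" where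
  "uniform_batch_sampling M n w1 B \<longleftrightarrow>
     (\<forall>k\<ge>1. B k \<in> measurable M (count_space (batches n))) \<and>
     (\<forall>k\<ge>1. \<forall>S\<in>batches n. AE x in M.
        real_cond_exp M (history M w1 B k) (indicator {y. B k y = S}) x =
        real_cond_exp M (history M w1 B k) (indicator {y. card (B k y) = card S}) x
          / real (n choose card S))"

text \<open>On \<open>real^'d\<close> the operations \<open>*\<close> and \<open>^\<close> are coordinate-wise.\<close>

definition vec_powr :: "real^'d::finite \<Rightarrow> real \<Rightarrow> real^'d" where
  "vec_powr v p = (\<chi> i. (v $ i) powr p)"

definition adam_iterates ::
  "real \<Rightarrow> real \<Rightarrow> real \<Rightarrow> real^'d::finite \<Rightarrow> real^'d \<Rightarrow> (nat \<Rightarrow> real^'d) \<Rightarrow>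
   (nat \<Rightarrow> real^'d) \<Rightarrow> (nat \<Rightarrow> real^'d) \<Rightarrow> (nat \<Rightarrow> real^'d) \<Rightarrow> bool" where
  "adam_iterates \<alpha> \<beta>1 \<beta>2 w1 v0 g m v w \<longleftrightarrow>
     w 1 = w1 \<and> m 0 = 0 \<and> v 0 = v0 \<and>
     (\<forall>k\<ge>1. m k = \<beta>1 *\<^sub>R m (k - 1) + (1 - \<beta>1) *\<^sub>R g k \<and>
            v k = \<beta>2 *\<^sub>R v (k - 1) + (1 - \<beta>2) *\<^sub>R (g k)^2 \<and>
            w (k + 1) = w k - \<alpha> *\<^sub>R (m k * vec_powr (v k) (-1/2)))"

definition coordinatewise_norm_test ::
  "'a measure \<Rightarrow> real \<Rightarrow> nat \<Rightarrow> (nat \<Rightarrow> real^'d::finite \<Rightarrow> real) \<Rightarrow>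
   (nat \<Rightarrow> 'a \<Rightarrow> nat set) \<Rightarrow> (nat \<Rightarrow> 'a \<Rightarrow> real^'d) \<Rightarrow> bool" where
  "coordinatewise_norm_test M \<eta> n l B w \<longleftrightarrow>
     (\<forall>k\<ge>1. \<forall>i. AE x in M.
        real_cond_exp M (history M (w 1) B k)
          (\<lambda>y. (batch_grad l (B k y) (w k y) $ i - partial i (risk n l) (w k y))^2) x
        \<le> \<eta>^2 * (partial i (risk n l) (w k x))^2)"

text \<open>Adam driven by random batches, from the deterministic initial data \<open>w1\<close>, \<open>v0\<close>.\<close>

definition adam_with_norm_test ::
  "real \<Rightarrow> real \<Rightarrow> real \<Rightarrow> real \<Rightarrow> nat \<Rightarrow> (nat \<Rightarrow> real^'d::finite \<Rightarrow> real) \<Rightarrow> real^'d \<Rightarrow> real^'d \<Rightarrow>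
   'a measure \<Rightarrow> (nat \<Rightarrow> 'a \<Rightarrow> nat set) \<Rightarrow> (nat \<Rightarrow> 'a \<Rightarrow> real^'d) \<Rightarrow> bool" where
  "adam_with_norm_test \<alpha> \<beta>1 \<beta>2 \<eta> n l w1 v0 M B w \<longleftrightarrow>
     prob_space M \<and>
     uniform_batch_sampling M n (w 1) B \<and>
     (\<exists>m v. \<forall>x\<in>space M.
        adam_iterates \<alpha> \<beta>1 \<beta>2 w1 v0 (\<lambda>k. batch_grad l (B k x) (w k x))
          (\<lambda>k. m k x) (\<lambda>k. v k x) (\<lambda>k. w k x)) \<and>
     coordinatewise_norm_test M \<eta> n l B w"

definition soft_O :: "(nat \<Rightarrow> real) \<Rightarrow> (nat \<Rightarrow> real) set" where
  "soft_O f = (\<Union>p::nat. O(\<lambda>K. f K * ln (real K) ^ p))"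

end

theory Submission
  imports Defs
begin

text \<open>
  Fix a coordinate and write \<open>G\<close> for the partial derivative of the risk at \<open>w\<^sub>k\<close>, \<open>g\<close> for its batch
  estimate, \<open>h = sqrt (\<beta>2 (v\<^sub>k\<^sub>-\<^sub>1 + 1))\<close> and \<open>r = sqrt (v\<^sub>k + 1)\<close>.  The denominator \<open>h\<close> is determined by
  the past, so \<open>G g / h\<close> has conditional mean \<open>G\<^sup>2 / h\<close>.  By Young's inequality the error of using \<open>h\<close>
  instead of \<open>r\<close>, in the gradient and in the momentum term alike, is at most a multiple of \<open>g\<^sup>2 / h\<close>,
  of conditional mean at most \<open>(1 + \<eta>\<^sup>2) G\<^sup>2 / h\<close> by the norm test, plus a multiple of
  \<open>G\<^sup>2 (1 / h - 1 / r)\<close>, which telescopes up to \<open>(1 - sqrt \<beta>2) G\<^sup>2 / h\<close>.  The bound on \<open>\<beta>1\<close> keeps the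
  total loss strictly below the gain \<open>G\<^sup>2 / h\<close>.  The descent inequality therefore bounds the sum of the
  expectations of \<open>G\<^sup>2 / h\<close> linearly in \<open>K\<close>; the recursion for \<open>v\<close> then does the same for \<open>h\<close>, and
  \<open>2 \<bar>G\<bar> \<le> G\<^sup>2 / h + h\<close> gives the claim, even without logarithmic factors.
\<close>

section \<open>One step of Adam in one coordinate\<close>

text \<open>The mean value theorem on the segment from \<open>x\<close> to \<open>y\<close> takes
  the place of the usual integral. It yields \<open>L\<close> instead of \<open>L / 2\<close>, which
  affects only constants in a bound of order \<open>K\<close>.\<close>

lemma descent_inequality:
  fixes f :: "real^'d::finite \<Rightarrow> real"
  assumes diff: "\<And>x. f differentiable (at x)"
    and lip: "\<And>x y. norm (grad f x - grad f y) \<le> L * norm (x - y)"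
    and "L \<ge> 0"
  shows "f y \<le> f x + grad f x \<bullet> (y - x) + L * (norm (y - x))\<^sup>2"
proof -
  define d where "d = y - x"
  have der: "((\<lambda>t. f (x + t *\<^sub>R d)) has_real_derivative grad f (x + t *\<^sub>R d) \<bullet> d) (at t)" for t
  proof -
    have "(f has_derivative (\<lambda>u. u \<bullet> grad f (x + t *\<^sub>R d))) (at (x + t *\<^sub>R d))"
      using GDERIV_grad[OF diff] by (simp add: gderiv_def)
    moreover have "((\<lambda>t. x + t *\<^sub>R d) has_derivative (\<lambda>t. t *\<^sub>R d)) (at t)"
      by (auto intro!: derivative_eq_intros)
    ultimately have "((\<lambda>t. f (x + t *\<^sub>R d)) has_derivative (\<lambda>u. (u *\<^sub>R d) \<bullet> grad f (x + t *\<^sub>R d))) (at t)"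
      by (rule has_derivative_compose[rotated])
    then show ?thesis
      by (simp add: has_field_derivative_def inner_commute mult.commute[of _ "d \<bullet> _"])
  qed
  obtain t where t: "0 < t" "t < 1"
    and eq: "f (x + 1 *\<^sub>R d) - f (x + 0 *\<^sub>R d) = (1 - 0) * (grad f (x + t *\<^sub>R d) \<bullet> d)"
    using MVT2[of 0 1 "\<lambda>t. f (x + t *\<^sub>R d)", OF zero_less_one der] by blast
  have "grad f (x + t *\<^sub>R d) \<bullet> d = grad f x \<bullet> d + (grad f (x + t *\<^sub>R d) - grad f x) \<bullet> d"
    by (simp add: inner_diff_left)
  also have "(grad f (x + t *\<^sub>R d) - grad f x) \<bullet> d \<le> norm (grad f (x + t *\<^sub>R d) - grad f x) * norm d"
    by (rule norm_cauchy_schwarz)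
  also have "\<dots> \<le> (L * norm d) * norm d"
  proof (rule mult_right_mono)
    have "norm (grad f (x + t *\<^sub>R d) - grad f x) \<le> L * (t * norm d)"
      using lip[of "x + t *\<^sub>R d" x] t by simp
    also have "\<dots> \<le> L * norm d"
      using t \<open>L \<ge> 0\<close> by (intro mult_left_mono) (auto simp: mult_left_le_one_le)
    finally show "norm (grad f (x + t *\<^sub>R d) - grad f x) \<le> L * norm d" .
  qed simp
  finally show ?thesis
    using eq by (simp add: d_def power2_eq_square mult.assoc)
qed

text \<open>Young's inequality with weight \<open>p = \<beta>1\<^sup>2 / \<beta>2\<close>: as
  \<open>\<beta>1\<^sup>2 / p = \<beta>2\<close>, the old squared momentum is discounted exactly
  like the old second moment, and \<open>C\<close> is the value at which the coefficients of
  \<open>g\<^sup>2\<close> agree as well. The bound therefore passes from one iteration to the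
  next.\<close>

lemma momentum_sq_le:
  fixes \<beta>1 \<beta>2 m v g C :: real
  assumes "0 < \<beta>1" "\<beta>1\<^sup>2 < \<beta>2" "\<beta>2 < 1"
    and C: "C = (1 - \<beta>1)\<^sup>2 / ((1 - \<beta>2) * (1 - \<beta>1\<^sup>2 / \<beta>2))"
    and m: "m\<^sup>2 \<le> C * v"
  shows "(\<beta>1 * m + (1 - \<beta>1) * g)\<^sup>2 \<le> C * (\<beta>2 * v + (1 - \<beta>2) * g\<^sup>2)"
proof -
  define p where "p = \<beta>1\<^sup>2 / \<beta>2"
  have b2: "0 < \<beta>2" using assms(1,2) by (meson less_trans zero_less_power)
  have p: "0 < p" "p < 1" using assms b2 by (auto simp: p_def)
  have young: "(a + b)\<^sup>2 \<le> a\<^sup>2 / p + b\<^sup>2 / (1 - p)" for a b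
  proof -
    have "a\<^sup>2 / p + b\<^sup>2 / (1 - p) - (a + b)\<^sup>2 = ((1 - p) * a - p * b)\<^sup>2 / (p * (1 - p))"
      using p by (simp add: divide_simps) algebra
    also have "\<dots> \<ge> 0" using p by simp
    finally show ?thesis by simp
  qed
  have "(\<beta>1 * m + (1 - \<beta>1) * g)\<^sup>2 \<le> (\<beta>1 * m)\<^sup>2 / p + ((1 - \<beta>1) * g)\<^sup>2 / (1 - p)"
    by (rule young)
  also have "(\<beta>1 * m)\<^sup>2 / p = \<beta>2 * m\<^sup>2"
    using assms(1) b2 by (simp add: p_def power_mult_distrib)
  also have "((1 - \<beta>1) * g)\<^sup>2 / (1 - p) = C * ((1 - \<beta>2) * g\<^sup>2)"
    using assms(3) p by (simp add: C p_def[symmetric] power_mult_distrib)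
  also have "\<beta>2 * m\<^sup>2 \<le> \<beta>2 * (C * v)"
    using m b2 by simp
  finally show ?thesis by (simp add: algebra_simps)
qed

section \<open>Constants derived from the parameters, and the slack in the bound on
  \<open>\<beta>1\<close>\<close>

locale adam_parameters =
  fixes \<beta>1 \<beta>2 \<eta> :: real
  assumes beta1_pos: "0 < \<beta>1"
    and beta2: "0 < \<beta>2" "\<beta>2 < 1"
    and beta1_le: "\<beta>1 \<le> sqrt \<beta>2 - 8 * (1 + \<eta>\<^sup>2) * (1 - \<beta>2) / \<beta>2\<^sup>2"
begin

text \<open>Discount factor of the normalised momentum: since \<open>h = sqrt \<beta>2 * r\<close>,
  the inherited part satisfies \<open>\<beta>1 * m / h = \<rho> * (m / r)\<close>.\<close>

definition \<rho> where "\<rho> = \<beta>1 / sqrt \<beta>2"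
definition s where "s = 1 + \<eta>\<^sup>2"
text \<open>Adds up the two errors of replacing \<open>r'\<close> by \<open>h\<close>:
  \<open>1\<close> comes from the fresh gradient, \<open>\<rho> / sqrt (1 - \<rho>\<^sup>2)\<close>
  from the momentum.\<close>

definition q where "q = 1 + \<rho> / sqrt (1 - \<rho>\<^sup>2)"
text \<open>Square root of the constant in \<open>momentum_sq_le\<close>, so
  \<open>\<bar>m\<bar> \<le> mratio * sqrt v\<close> along every trajectory.\<close>

definition mratio where "mratio = (1 - \<beta>1) / sqrt ((1 - \<beta>2) * (1 - \<rho>\<^sup>2))"

lemma s_ge_1: "s \<ge> 1"
  by (simp add: s_def)

lemma sqrt_beta2: "0 < sqrt \<beta>2" "sqrt \<beta>2 < 1"
  using beta2 by auto

text \<open>Divide the hypothesis on \<open>\<beta>1\<close> by \<open>sqrt \<beta>2\<close> and use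
  \<open>sqrt \<beta>2 * \<beta>2\<^sup>2 \<le> 1\<close>. Both \<open>\<rho> < 1\<close> and
  \<open>telescoping_loss_le\<close> draw on the hypothesis through this inequality.\<close>

lemma rho_gap: "8 * s * (1 - \<beta>2) \<le> 1 - \<rho>"
proof -
  have "8 * s * (1 - \<beta>2) * (sqrt \<beta>2 * \<beta>2\<^sup>2) \<le> 8 * s * (1 - \<beta>2) * 1"
    using beta2 sqrt_beta2 s_ge_1
    by (intro mult_left_mono mult_le_one) (auto simp: power_le_one)
  then have "8 * s * (1 - \<beta>2) * sqrt \<beta>2 \<le> 8 * s * (1 - \<beta>2) / \<beta>2\<^sup>2"
    using beta2 by (simp add: field_simps)
  also have "\<dots> \<le> sqrt \<beta>2 - \<beta>1"
    using beta1_le by (simp add: s_def)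
  finally have "8 * s * (1 - \<beta>2) \<le> (sqrt \<beta>2 - \<beta>1) / sqrt \<beta>2"
    using sqrt_beta2 by (simp add: field_simps)
  also have "\<dots> = 1 - \<rho>"
    using beta2 by (simp add: \<rho>_def diff_divide_distrib)
  finally show ?thesis .
qed

lemma rho: "0 < \<rho>" "\<rho> < 1"
proof -
  show "0 < \<rho>" using beta1_pos sqrt_beta2 by (simp add: \<rho>_def)
  have "0 < 8 * s * (1 - \<beta>2)" using s_ge_1 beta2 by simp
  then show "\<rho> < 1" using rho_gap by linarith
qed

lemma rho_sq: "0 < \<rho>\<^sup>2" "\<rho>\<^sup>2 < 1"
  using rho by (auto simp: power_less_one_iff abs_square_less_1)

lemma beta1_eq: "\<beta>1 = \<rho> * sqrt \<beta>2"
  using sqrt_beta2(1) by (simp add: \<rho>_def)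

lemma beta1_sq_less: "\<beta>1\<^sup>2 < \<beta>2"
  using rho_sq beta2 by (simp add: \<rho>_def power_divide)

lemma beta1_less_1: "\<beta>1 < 1"
  using rho sqrt_beta2 mult_strict_mono[of \<rho> 1 "sqrt \<beta>2" 1] beta1_eq by simp

lemma q_pos: "q > 0"
  using rho rho_sq by (auto simp: q_def intro!: add_pos_nonneg)

lemma mratio_pos: "mratio > 0"
  using beta1_less_1 beta2 rho_sq by (simp add: mratio_def)

lemma mratio_sq: "mratio\<^sup>2 = (1 - \<beta>1)\<^sup>2 / ((1 - \<beta>2) * (1 - \<beta>1\<^sup>2 / \<beta>2))"
  using beta2 rho_sq by (simp add: mratio_def power_divide \<rho>_def)

text \<open>Gives the momentum error in \<open>drift_raw\<close> the factor
  \<open>sqrt (1 - \<beta>2)\<close> that the gradient error has, so that both merge into one term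
  with coefficient \<open>q\<close>.\<close>

lemma rho_mratio: "\<rho> * mratio * (1 - \<beta>2) = (1 - \<beta>1) * (q - 1) * sqrt (1 - \<beta>2)"
proof -
  define t u where "t = sqrt (1 - \<beta>2)" and "u = sqrt (1 - \<rho>\<^sup>2)"
  have tu: "t > 0" "u > 0" "1 - \<beta>2 = t * t" using beta2 rho_sq by (auto simp: t_def u_def)
  have "mratio = (1 - \<beta>1) / (t * u)" "q - 1 = \<rho> / u"
    by (simp_all add: mratio_def q_def t_def u_def real_sqrt_mult)
  then show ?thesis unfolding t_def[symmetric] using tu by simp
qed

text \<open>Here the \<open>8\<close> of the hypothesis pays off: \<open>q\<^sup>2\<close> is at
  most \<open>2 / (1 - \<rho>)\<close>, while \<open>rho_gap\<close> bounds
  \<open>8 * s * (1 - sqrt \<beta>2)\<close> by \<open>1 - \<rho>\<close>, so the product is at most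
  \<open>2 / 8\<close>.\<close>

lemma telescoping_loss_le: "q\<^sup>2 * s * (1 - sqrt \<beta>2) \<le> 1 / 4"
proof -
  have "q\<^sup>2 \<le> 2 + 2 * (\<rho> / sqrt (1 - \<rho>\<^sup>2))\<^sup>2"
    using sum_squares_bound[of 1 "\<rho> / sqrt (1 - \<rho>\<^sup>2)"] by (simp add: q_def power2_sum)
  also have "\<dots> = 2 / (1 - \<rho>\<^sup>2)"
    using rho_sq by (simp add: power_divide field_simps)
  also have "\<dots> \<le> 2 / (1 - \<rho>)"
  proof -
    have "\<rho>\<^sup>2 \<le> \<rho>" using rho by (simp add: power2_eq_square)
    then show ?thesis using rho by (intro divide_left_mono) (auto simp: rho_sq)
  qed
  finally have q: "q\<^sup>2 \<le> 2 / (1 - \<rho>)" .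
  have "(1 - sqrt \<beta>2) \<le> 1 - \<beta>2"
    using beta2 sqrt_beta2 by (simp add: real_le_rsqrt power2_eq_square)
  then have "q\<^sup>2 * (8 * s * (1 - sqrt \<beta>2)) \<le> q\<^sup>2 * (8 * s * (1 - \<beta>2))"
    using s_ge_1 by (intro mult_left_mono) auto
  also have "\<dots> \<le> q\<^sup>2 * (1 - \<rho>)"
    using rho_gap by (intro mult_left_mono) auto
  also have "\<dots> \<le> 2 / (1 - \<rho>) * (1 - \<rho>)"
    using q rho by (intro mult_right_mono) auto
  also have "\<dots> = 2" using rho by (simp del: left_diff_distrib_numeral right_diff_distrib_numeral add: nonzero_divide_eq_eq)
  finally have "q\<^sup>2 * (8 * s * (1 - sqrt \<beta>2)) \<le> 2" .
  moreover have "q\<^sup>2 * (8 * s * (1 - sqrt \<beta>2)) = 8 * (q\<^sup>2 * s * (1 - sqrt \<beta>2))"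
    by (simp only: ac_simps)
  ultimately show ?thesis by linarith
qed

text \<open>
  The shift \<open>v + 1\<close> keeps the denominators away from \<open>0\<close>, since \<open>v\<close> alone may decay to \<open>0\<close>
  geometrically; its cost is \<open>regularisation_loss\<close>.
\<close>

context
  fixes G G' g m v m' v' c r h r' :: real
  assumes v: "v \<ge> 0" and m: "m\<^sup>2 \<le> mratio\<^sup>2 * v" and close: "\<bar>G - G'\<bar> \<le> c"
    and m': "m' = \<beta>1 * m + (1 - \<beta>1) * g"
    and v': "v' = \<beta>2 * v + (1 - \<beta>2) * g\<^sup>2"
  defines "r \<equiv> sqrt (v + 1)" and "h \<equiv> sqrt \<beta>2 * sqrt (v + 1)" and "r' \<equiv> sqrt (v' + 1)"
begin

lemma r_h: "r \<ge> 1" "0 < h" "h \<le> r" "sqrt \<beta>2 \<le> h"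
  using v beta2 sqrt_beta2 by (auto simp: r_def h_def mult_left_le_one_le)

text \<open>The squares of \<open>r'\<close> and \<open>h\<close> differ by the contribution of the
  new gradient and the discounted part of the shift. The factored form gives \<open>r' - h\<close>
  as a quotient, which is how every later estimate uses it.\<close>

lemma r'_sq: "(r' - h) * (r' + h) = (1 - \<beta>2) * (g\<^sup>2 + 1)"
proof -
  have "r'\<^sup>2 = v' + 1" using v beta2 by (simp add: r'_def v')
  moreover have "h\<^sup>2 = \<beta>2 * (v + 1)" using v beta2 by (simp add: h_def power_mult_distrib)
  ultimately show ?thesis by (simp add: v' algebra_simps power2_eq_square)
qed

lemma h_less_r': "h < r'"
proof -
  have "0 \<le> v'" using v beta2 by (simp add: v')
  then have "0 < r' + h" using r_h by (simp add: r'_def add_nonneg_pos)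
  moreover have "0 < (r' - h) * (r' + h)" unfolding r'_sq using beta2
    by (intro mult_pos_pos) (auto intro: add_nonneg_pos)
  ultimately show ?thesis by (simp add: zero_less_mult_iff)
qed

lemma momentum_le: "\<bar>m\<bar> \<le> mratio * r"
proof -
  have "m\<^sup>2 \<le> mratio\<^sup>2 * (v + 1)" using m by (simp add: distrib_left add_increasing2)
  then have "m\<^sup>2 \<le> (mratio * r)\<^sup>2" using v by (simp add: r_def power_mult_distrib)
  then show ?thesis using mratio_pos r_h abs_le_square_iff[of m "mratio * r"] by simp
qed

lemma abs_g_le: "sqrt (1 - \<beta>2) * \<bar>g\<bar> \<le> r'"
proof -
  have "(sqrt (1 - \<beta>2) * \<bar>g\<bar>)\<^sup>2 \<le> v' + 1"
    using v beta2 by (simp add: v' power_mult_distrib)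
  then show ?thesis unfolding r'_def by (rule real_le_rsqrt)
qed

text \<open>Replacing \<open>r'\<close> by \<open>h\<close> separates two main terms:
  \<open>G * g / h\<close>, whose denominator is known before the batch is drawn, and the momentum
  term, which becomes \<open>\<rho>\<close> times the same quantity of the preceding step. The
  replacement error \<open>\<Delta>\<close> is proportional to \<open>g\<^sup>2 + 1\<close> and must
  absorb a further factor \<open>\<bar>g\<bar>\<close> or \<open>\<bar>m\<bar>\<close>.\<close>

lemma drift_raw:
  "G * m' / r' \<ge> (1 - \<beta>1) * (G * g / h) + \<rho> * (G' * m / r) - \<rho> * c * mratio
     - (1 - \<beta>1) * (q * \<bar>G\<bar> * (sqrt (1 - \<beta>2) * (g\<^sup>2 + 1) / (r' + h)) / h)"
proof -
  define \<Delta> W where "\<Delta> = 1 / h - 1 / r'" and "W = (g\<^sup>2 + 1) / (r' + h)"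
  define t where "t = sqrt (1 - \<beta>2)"
  have t: "t > 0" "1 - \<beta>2 = t * t" using beta2 by (auto simp: t_def)
  have r'pos: "r' > 0" using h_less_r' r_h by simp
  have W: "W \<ge> 0" using r_h r'pos by (simp add: W_def)
  have "r' - h = (1 - \<beta>2) * W"
    unfolding W_def times_divide_eq_right r'_sq[symmetric] using r_h r'pos by simp
  then have \<Delta>: "\<Delta> = (1 - \<beta>2) * W / (r' * h)"
    using r_h r'pos by (simp add: \<Delta>_def diff_frac_eq mult.commute)
  have \<Delta>_nonneg: "\<Delta> \<ge> 0" using \<Delta> W beta2 r_h r'pos by simp
  have g\<Delta>: "\<bar>g\<bar> * \<Delta> \<le> t * W / h"
  proof -
    \<comment> \<open>The factor \<open>1 - \<beta>2\<close> is split as \<open>t * t\<close>: one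
      \<open>t\<close> joins \<open>\<bar>g\<bar>\<close> and is absorbed by \<open>r'\<close>, the
      other survives in the error.\<close>
    have "\<bar>g\<bar> * \<Delta> = (t * \<bar>g\<bar> / r') * (t * W / h)"
      unfolding \<Delta> t(2) by (simp only: divide_inverse inverse_mult_distrib ac_simps)
    also have "\<dots> \<le> 1 * (t * W / h)"
      using abs_g_le r'pos W t(1) r_h by (intro mult_right_mono) (auto simp: t_def)
    finally show ?thesis by simp
  qed
  have m\<Delta>: "\<beta>1 * \<bar>m\<bar> * \<Delta> \<le> (1 - \<beta>1) * (q - 1) * (t * W / h)"
  proof -
    \<comment> \<open>The bound on \<open>m\<close> produces
      \<open>\<beta>1 * r = \<rho> * h\<close>, which cancels the \<open>h\<close> in
      \<open>\<Delta>\<close>. At the end \<open>W / r'\<close> is enlarged to \<open>W / h\<close>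
      only to match the gradient error.\<close>
    have "\<beta>1 * \<bar>m\<bar> * \<Delta> \<le> \<beta>1 * (mratio * r) * \<Delta>"
      using momentum_le beta1_pos \<Delta>_nonneg by (intro mult_right_mono mult_left_mono) auto
    also have "\<dots> = \<rho> * mratio * (1 - \<beta>2) * (W / r')"
      using r_h r'pos by (simp add: \<Delta> \<rho>_def h_def r_def[symmetric] mult_ac)
    also have "\<dots> = (1 - \<beta>1) * (q - 1) * (t * (W / r'))"
      unfolding rho_mratio by (simp add: t_def)
    also have "\<dots> \<le> (1 - \<beta>1) * (q - 1) * (t * (W / h))"
      using beta1_less_1 rho rho_sq t(1) W h_less_r' r_h
      by (intro mult_left_mono divide_left_mono mult_nonneg_nonneg mult_pos_pos) (auto simp: q_def)
    finally show ?thesis by simp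
  qed
  have 1: "G * g / r' \<ge> G * g / h - \<bar>G\<bar> * (t * W / h)"
  proof -
    have "G * g * \<Delta> \<le> \<bar>G\<bar> * (\<bar>g\<bar> * \<Delta>)"
      using \<Delta>_nonneg by (metis abs_ge_self abs_mult abs_of_nonneg mult.assoc)
    also have "\<dots> \<le> \<bar>G\<bar> * (t * W / h)" using g\<Delta> by (intro mult_left_mono) auto
    finally show ?thesis by (simp add: \<Delta>_def algebra_simps)
  qed
  have 2: "\<beta>1 * (G * m / r') \<ge> \<rho> * (G * m / r) - \<bar>G\<bar> * ((1 - \<beta>1) * (q - 1) * (t * W / h))"
  proof -
    have "\<beta>1 * (G * m) * \<Delta> \<le> \<bar>G\<bar> * (\<beta>1 * \<bar>m\<bar> * \<Delta>)"
      using \<Delta>_nonneg beta1_pos abs_ge_self[of "G * m"] mult_right_mono[of "G * m" "\<bar>G * m\<bar>" "\<beta>1 * \<Delta>"]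
      by (simp add: abs_mult mult_ac)
    also have "\<dots> \<le> \<bar>G\<bar> * ((1 - \<beta>1) * (q - 1) * (t * W / h))" using m\<Delta> by (intro mult_left_mono) auto
    finally have "\<beta>1 * (G * m) / h - \<beta>1 * (G * m) / r' \<le> \<bar>G\<bar> * ((1 - \<beta>1) * (q - 1) * (t * W / h))"
      by (simp add: \<Delta>_def algebra_simps)
    moreover have "\<beta>1 * (G * m) / h = \<rho> * (G * m / r)"
      using sqrt_beta2 by (simp add: h_def r_def[symmetric] \<rho>_def)
    ultimately show ?thesis by simp
  qed
  \<comment> \<open>The momentum \<open>m\<close> was paired with the previous gradient
    \<open>G'\<close> one step earlier. Exchanging \<open>G\<close> for \<open>G'\<close> costs a
    constant, because \<open>m / r\<close> is bounded by \<open>mratio\<close>.\<close>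
  have 3: "\<rho> * (G * m / r) \<ge> \<rho> * (G' * m / r) - \<rho> * c * mratio"
  proof -
    have "(G' - G) * (m / r) \<le> \<bar>G - G'\<bar> * \<bar>m / r\<bar>"
      by (metis abs_ge_self abs_minus_commute abs_mult)
    also have "\<dots> \<le> c * mratio"
      using close momentum_le r_h by (intro mult_mono) (auto simp: field_simps)
    finally have "\<rho> * ((G' - G) * (m / r)) \<le> \<rho> * (c * mratio)"
      using rho by (intro mult_left_mono) auto
    then show ?thesis by (simp add: algebra_simps diff_divide_distrib)
  qed
  have "G * m' / r' = (1 - \<beta>1) * (G * g / r') + \<beta>1 * (G * m / r')"
    by (simp add: m' algebra_simps add_divide_distrib diff_divide_distrib)
  also have "\<dots> \<ge> (1 - \<beta>1) * (G * g / h - \<bar>G\<bar> * (t * W / h)) + \<beta>1 * (G * m / r')"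
    using 1 beta1_less_1 by (intro add_right_mono mult_left_mono) auto
  finally have "G * m' / r' \<ge> (1 - \<beta>1) * (G * g / h - \<bar>G\<bar> * (t * W / h)) + \<beta>1 * (G * m / r')" .
  moreover have "sqrt (1 - \<beta>2) * (g\<^sup>2 + 1) / (r' + h) = t * W" by (simp add: t_def W_def)
  moreover have "(1 - \<beta>1) * (G * g / h - \<bar>G\<bar> * (t * W / h)) - \<bar>G\<bar> * ((1 - \<beta>1) * (q - 1) * (t * W / h))
      = (1 - \<beta>1) * (G * g / h) - (1 - \<beta>1) * (q * \<bar>G\<bar> * (t * W) / h)"
    by (simp add: algebra_simps add_divide_distrib diff_divide_distrib)
  ultimately show ?thesis using 2 3 by (simp only:)
qed

text \<open>One factor \<open>\<gamma> = sqrt (g\<^sup>2 + 1)\<close> is kept apart from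
  \<open>X\<close>, and Young's inequality is applied to \<open>X * \<gamma>\<close>. The weight
  \<open>s\<close> makes the \<open>g\<^sup>2\<close> part cost half of the gain in conditional
  mean. In \<open>X\<^sup>2\<close> the other factor \<open>\<gamma>\<close> is used up by
  \<open>r'_sq\<close>, which turns it into the difference \<open>1 / h - 1 / r'\<close>.\<close>

lemma young_loss:
  "q * \<bar>G\<bar> * (sqrt (1 - \<beta>2) * (g\<^sup>2 + 1) / (r' + h)) / h
    \<le> (g\<^sup>2 + 1) / h / (2 * s) + q\<^sup>2 * s / 2 * (G\<^sup>2 * (1 / h - 1 / r'))"
proof -
  have r'pos: "r' > 0" using h_less_r' r_h by simp
  have s: "s > 0" using s_ge_1 by simp
  define \<gamma> u where "\<gamma> = sqrt (g\<^sup>2 + 1)" and "u = sqrt (1 - \<beta>2) * \<gamma> / (r' + h)"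
  define X where "X = q * \<bar>G\<bar> * u"
  have \<gamma>: "\<gamma> * \<gamma> = g\<^sup>2 + 1" by (simp add: \<gamma>_def)
  have "u\<^sup>2 = ((1 - \<beta>2) * (g\<^sup>2 + 1)) / (r' + h)\<^sup>2"
    using beta2 by (simp add: u_def power_divide power_mult_distrib \<gamma>_def)
  also have "\<dots> = (r' - h) / (r' + h)"
    unfolding r'_sq[symmetric] using r'pos r_h by (simp add: power2_eq_square)
  also have "\<dots> \<le> (r' - h) / r'"
    using r'pos r_h h_less_r' by (intro divide_left_mono) auto
  finally have u: "u\<^sup>2 \<le> (r' - h) / r'" .
  have "0 \<le> (\<gamma> - s * X)\<^sup>2" by simp
  then have "s * (2 * (X * \<gamma>)) \<le> \<gamma> * \<gamma> + s * (s * X\<^sup>2)"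
    by (simp add: power2_diff power_mult_distrib power2_eq_square algebra_simps)
  then have "X * \<gamma> \<le> \<gamma> * \<gamma> / (2 * s) + s / 2 * X\<^sup>2"
    using s by (simp add: field_simps)
  also have "X\<^sup>2 = q\<^sup>2 * G\<^sup>2 * u\<^sup>2" by (simp add: X_def power_mult_distrib)
  also have "s / 2 * (q\<^sup>2 * G\<^sup>2 * u\<^sup>2) \<le> s / 2 * (q\<^sup>2 * G\<^sup>2 * ((r' - h) / r'))"
    using u s by (intro mult_left_mono) auto
  finally have "X * \<gamma> / h \<le> ((g\<^sup>2 + 1) / (2 * s) + s / 2 * (q\<^sup>2 * G\<^sup>2 * ((r' - h) / r'))) / h"
    using r_h unfolding \<gamma> by (intro divide_right_mono) auto
  also have "\<dots> = (g\<^sup>2 + 1) / h / (2 * s) + q\<^sup>2 * s / 2 * (G\<^sup>2 * ((r' - h) / r' / h))"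
    by (simp only: divide_inverse inverse_mult_distrib distrib_left distrib_right ac_simps)
  also have "(r' - h) / r' / h = 1 / h - 1 / r'"
    using r'pos r_h by (simp add: diff_divide_distrib)
  also have "X * \<gamma> / h = q * \<bar>G\<bar> * (sqrt (1 - \<beta>2) * (\<gamma> * \<gamma>) / (r' + h)) / h"
    by (simp add: X_def u_def mult_ac)
  finally show ?thesis unfolding \<gamma> .
qed

text \<open>Insert \<open>G\<^sup>2 / r\<close> between the two terms. As
  \<open>G\<^sup>2 / r\<close> equals \<open>sqrt \<beta>2 * (G\<^sup>2 / h)\<close>, the first gap
  is a small multiple of the gain. In the second gap \<open>G\<close> is exchanged for
  \<open>G'\<close> to obtain a telescoping difference, at the price of
  \<open>\<epsilon> * (G\<^sup>2 / h)\<close> and a constant.\<close>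

lemma telescoping_bound:
  assumes "\<epsilon> > 0"
  shows "G\<^sup>2 * (1 / h - 1 / r')
    \<le> (1 - sqrt \<beta>2 + \<epsilon>) * (G\<^sup>2 / h) + (G'\<^sup>2 / r - G\<^sup>2 / r') + c\<^sup>2 / \<epsilon>"
proof -
  define e where "e = G - G'"
  have c: "c \<ge> 0" using close by linarith
  have e2: "2 * (G * e) \<le> \<epsilon> * G\<^sup>2 + c\<^sup>2 / \<epsilon>"
  proof -
    have "0 \<le> (\<epsilon> * G - e)\<^sup>2" by simp
    then have "\<epsilon> * (2 * (G * e)) \<le> \<epsilon> * (\<epsilon> * G\<^sup>2) + e\<^sup>2"
      by (simp add: power2_diff power_mult_distrib power2_eq_square algebra_simps)
    also have "e\<^sup>2 \<le> c\<^sup>2" using close c by (simp add: e_def abs_le_square_iff[symmetric])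
    finally show ?thesis using assms by (simp add: field_simps)
  qed
  have "G\<^sup>2 = G'\<^sup>2 + 2 * (G * e) - e\<^sup>2" by (simp add: e_def power2_eq_square algebra_simps)
  then have "G\<^sup>2 \<le> G'\<^sup>2 + (\<epsilon> * G\<^sup>2 + c\<^sup>2 / \<epsilon>)"
    using e2 zero_le_power2[of e] by linarith
  then have "G\<^sup>2 / r \<le> (G'\<^sup>2 + (\<epsilon> * G\<^sup>2 + c\<^sup>2 / \<epsilon>)) / r"
    using r_h by (intro divide_right_mono) auto
  also have "\<dots> = G'\<^sup>2 / r + \<epsilon> * (G\<^sup>2 / r) + c\<^sup>2 / \<epsilon> / r"
    by (simp add: add_divide_distrib)
  also have "\<dots> \<le> G'\<^sup>2 / r + \<epsilon> * (G\<^sup>2 / h) + c\<^sup>2 / \<epsilon> / 1"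
    using r_h assms c by (intro add_mono mult_left_mono divide_left_mono) auto
  finally have "G\<^sup>2 / r \<le> G'\<^sup>2 / r + \<epsilon> * (G\<^sup>2 / h) + c\<^sup>2 / \<epsilon>" by simp
  moreover have "G\<^sup>2 / r = sqrt \<beta>2 * (G\<^sup>2 / h)"
    using sqrt_beta2 by (simp add: h_def r_def[symmetric])
  ultimately show ?thesis by (simp add: algebra_simps add_divide_distrib diff_divide_distrib)
qed

text \<open>The actual step divides by \<open>sqrt v'\<close>, not by \<open>r'\<close>. The change
  is harmless even for tiny \<open>v'\<close>, because \<open>\<bar>m'\<bar>\<close> is itself of
  order \<open>sqrt v'\<close> and \<open>r'\<close> exceeds \<open>sqrt v'\<close> by at most
  \<open>1\<close>; so it is at most \<open>\<bar>G\<bar> * mratio / h\<close>, which Young's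
  inequality splits.\<close>

lemma regularisation_loss:
  assumes "v' > 0" and m'_le: "\<bar>m'\<bar> \<le> mratio * sqrt v'" and "\<epsilon> > 0"
  shows "G * m' / r' \<le> G * m' / sqrt v' + \<epsilon> * (G\<^sup>2 / h) + mratio\<^sup>2 / (4 * \<epsilon> * sqrt \<beta>2)"
proof -
  define w where "w = sqrt v'"
  have w: "w > 0" using assms by (simp add: w_def)
  have r'w: "w \<le> r'" "r' \<le> w + 1"
    using assms by (auto simp: w_def r'_def intro!: real_le_lsqrt simp: power2_sum)
  have r'pos: "r' > 0" using w r'w by simp
  have "G * m' / r' - G * m' / w \<le> \<bar>G\<bar> * (\<bar>m'\<bar> * (1 / w - 1 / r'))"
  proof -
    have "G * m' / r' - G * m' / w = - (G * m') * (1 / w - 1 / r')" by (simp add: algebra_simps)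
    also have "\<dots> \<le> \<bar>G * m'\<bar> * (1 / w - 1 / r')"
      using w r'w r'pos by (intro mult_right_mono) (auto simp: frac_le)
    finally show ?thesis by (simp add: abs_mult mult_ac)
  qed
  also have "\<dots> \<le> \<bar>G\<bar> * (mratio * 1 / h)"
  proof (rule mult_left_mono)
    have "\<bar>m'\<bar> * (1 / w - 1 / r') \<le> (mratio * w) * (1 / w - 1 / r')"
      using m'_le w r'w r'pos by (intro mult_right_mono) (auto simp: w_def frac_le)
    also have "\<dots> = mratio * (r' - w) / r'" using w r'pos by (simp add: field_simps)
    also have "\<dots> \<le> mratio * 1 / h"
      using mratio_pos r_h r'w h_less_r' by (intro frac_le mult_left_mono) auto
    finally show "\<bar>m'\<bar> * (1 / w - 1 / r') \<le> mratio * 1 / h" .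
  qed simp
  finally have 1: "G * m' / r' - G * m' / w \<le> (\<bar>G\<bar> * mratio) / h" by simp
  have "0 \<le> (2 * \<epsilon> * \<bar>G\<bar> - mratio)\<^sup>2" by simp
  then have "4 * \<epsilon> * (\<bar>G\<bar> * mratio) \<le> 4 * \<epsilon> * (\<epsilon> * \<bar>G\<bar>\<^sup>2) + mratio\<^sup>2"
    by (simp del: power2_abs abs_mult_self_eq add: power2_diff power_mult_distrib power2_eq_square algebra_simps)
  then have "\<bar>G\<bar> * mratio \<le> \<epsilon> * G\<^sup>2 + mratio\<^sup>2 / (4 * \<epsilon>)"
    using assms by (simp add: field_simps)
  then have "(\<bar>G\<bar> * mratio) / h \<le> (\<epsilon> * G\<^sup>2 + mratio\<^sup>2 / (4 * \<epsilon>)) / h"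
    using r_h by (intro divide_right_mono) auto
  also have "\<dots> = \<epsilon> * (G\<^sup>2 / h) + mratio\<^sup>2 / (4 * \<epsilon>) / h" by (simp add: add_divide_distrib)
  also have "mratio\<^sup>2 / (4 * \<epsilon>) / h \<le> mratio\<^sup>2 / (4 * \<epsilon>) / sqrt \<beta>2"
    using sqrt_beta2 assms(3) by (intro divide_left_mono mult_pos_pos r_h) auto
  finally show ?thesis using 1 by (simp add: w_def)
qed

text \<open>Here \<open>r - h = (1 - sqrt \<beta>2) * r\<close>, and \<open>r' - h\<close> is
  estimated through \<open>r'_sq\<close>. Summed over the iterations, this bounds the denominators
  themselves by a telescoping sum and the sum of \<open>(g\<^sup>2 + 1) / h\<close>.\<close>

lemma denominator_growth:
  "(1 - sqrt \<beta>2) * r \<le> r - r' + (1 - \<beta>2) / 2 * ((g\<^sup>2 + 1) / h)"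
proof -
  have "r' - h = (1 - \<beta>2) * (g\<^sup>2 + 1) / (r' + h)"
    unfolding r'_sq[symmetric] using h_less_r' r_h by simp
  also have "\<dots> \<le> (1 - \<beta>2) * (g\<^sup>2 + 1) / (2 * h)"
    using beta2 h_less_r' r_h by (intro divide_left_mono) auto
  finally show ?thesis by (simp add: h_def r_def algebra_simps)
qed

lemma abs_le_quadratic: "\<bar>G\<bar> \<le> (G\<^sup>2 / h + r) / 2"
proof -
  have "0 \<le> (\<bar>G\<bar> - h)\<^sup>2" by simp
  then have "2 * \<bar>G\<bar> * h \<le> G\<^sup>2 + h * h"
    by (simp add: power2_diff power2_eq_square algebra_simps)
  then have "2 * \<bar>G\<bar> \<le> G\<^sup>2 / h + h"
    using r_h by (simp add: field_simps)
  then show ?thesis using r_h by simp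
qed

end

text \<open>
  Along a trajectory the \<open>c2\<close> term has expectation \<open>0\<close>, the \<open>c3\<close> term has expectation at most \<open>0\<close>,
  and the two bracketed terms telescope.
\<close>

lemma one_step_bound:
  obtains c1 c2 c3 c4 cx cp cr :: real
  where "0 \<le> c1" "0 \<le> c2" "0 \<le> c3" "0 \<le> c4" "0 \<le> cx" "0 \<le> cp" "0 \<le> cr"
    and "\<And>G G' g m v m' v' h. v > 0 \<Longrightarrow> m\<^sup>2 \<le> mratio\<^sup>2 * v \<Longrightarrow> \<bar>G - G'\<bar> \<le> c \<Longrightarrow>
      m' = \<beta>1 * m + (1 - \<beta>1) * g \<Longrightarrow> v' = \<beta>2 * v + (1 - \<beta>2) * g\<^sup>2 \<Longrightarrow>
      h = sqrt \<beta>2 * sqrt (v + 1) \<Longrightarrow>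
      \<bar>G\<bar> \<le> c1 * (G * m' / sqrt v') - c2 * ((G * g - G\<^sup>2) / h) + c3 * ((g\<^sup>2 - s * G\<^sup>2) / h) + c4
        + (cx * (G * m' / sqrt (v' + 1)) - cp * (G\<^sup>2 / sqrt (v' + 1)) - cr * sqrt (v' + 1))
        - (cx * (G' * m / sqrt (v + 1)) - cp * (G'\<^sup>2 / sqrt (v + 1)) - cr * sqrt (v + 1))"
proof -
  \<comment> \<open>Budget for the gain \<open>b * A\<close> with \<open>A = G\<^sup>2 / h\<close>:
    Young's inequality takes a half, the telescoping a quarter
    (\<open>k * \<epsilon> = 1 / 8\<close> plus at most \<open>1 / 8\<close> from
    \<open>telescoping_loss_le\<close>), the regularisation an eighth
    (\<open>(1 - \<rho>) * \<epsilon>' = b / 8\<close>). What remains is \<open>b * A / 8\<close>,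
    whence the factor \<open>8 / b\<close> in the constants.\<close>
  define b \<epsilon> \<epsilon>' where "b = 1 - \<beta>1" and "\<epsilon> = 1 / (4 * (q\<^sup>2 * s))" and "\<epsilon>' = b / (8 * (1 - \<rho>))"
  define k where "k = q\<^sup>2 * s / 2"
  \<comment> \<open>The absolute value of \<open>c\<close> makes \<open>K\<close> nonnegative at
    once; \<open>c \<ge> 0\<close> follows only inside, from a given instance of
    \<open>close\<close>.\<close>
  define K where "K = b * (1 / sqrt \<beta>2 / (2 * s)) + b * k * (c\<^sup>2 / \<epsilon>) + \<rho> * \<bar>c\<bar> * mratio
    + (1 - \<rho>) * (mratio\<^sup>2 / (4 * \<epsilon>' * sqrt \<beta>2))"
  \<comment> \<open>The value of \<open>a\<close> normalises \<open>denominator_growth\<close> to a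
    bound on \<open>r / 2\<close>. Then \<open>a1\<close> is the total coefficient of
    \<open>A\<close>: a half from \<open>abs_le_quadratic\<close>, the rest from bounding
    \<open>Q\<close> in that growth estimate.\<close>
  define a where "a = 1 / (2 * (1 - sqrt \<beta>2))"
  define a1 where "a1 = 1 / 2 + a * ((1 - \<beta>2) / 2) * s"
  have pos: "b > 0" "\<epsilon> > 0" "\<epsilon>' > 0" "k > 0" "K \<ge> 0" "a > 0" "a1 > 0" "s > 0"
  proof -
    show s: "s > 0" using s_ge_1 by simp
    show b: "b > 0" using beta1_less_1 by (simp add: b_def)
    show e: "\<epsilon> > 0" "\<epsilon>' > 0" using b s q_pos rho by (auto simp: \<epsilon>_def \<epsilon>'_def)
    show k: "k > 0" using s q_pos by (simp add: k_def)
    show "K \<ge> 0" unfolding K_def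
      using b e k s rho mratio_pos sqrt_beta2 by (intro add_nonneg_nonneg mult_nonneg_nonneg divide_nonneg_nonneg) auto
    show a: "a > 0" using sqrt_beta2 by (simp add: a_def)
    show "a1 > 0" unfolding a1_def using a s beta2
      by (intro add_pos_nonneg mult_nonneg_nonneg) auto
  qed
  show thesis
  proof (rule that[of "a1 * (8 / b * (1 - \<rho>))" "a1 * 8" "a1 * (4 / s) + a * ((1 - \<beta>2) / 2)"
        "a1 * (8 / b * K) + a * ((1 - \<beta>2) / 2) * (1 / sqrt \<beta>2)" "a1 * (8 / b * \<rho>)" "a1 * (8 * k)" a])
    fix G G' g m v m' v' h :: real
    assume v: "v > 0" and m: "m\<^sup>2 \<le> mratio\<^sup>2 * v" and close: "\<bar>G - G'\<bar> \<le> c"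
      and m': "m' = \<beta>1 * m + (1 - \<beta>1) * g"
      and v': "v' = \<beta>2 * v + (1 - \<beta>2) * g\<^sup>2"
      and h: "h = sqrt \<beta>2 * sqrt (v + 1)"
    note * = less_imp_le[OF v] m close m' v'
    define r r' where "r = sqrt (v + 1)" and "r' = sqrt (v' + 1)"
    note folds = r_def[symmetric] r'_def[symmetric] h[folded r_def, symmetric]
    define A D1 D2 y x x' P P' where "A = G\<^sup>2 / h" and "D1 = (G * g - G\<^sup>2) / h"
      and "D2 = (g\<^sup>2 - s * G\<^sup>2) / h" and "y = G * m' / sqrt v'"
      and "x = G' * m / r" and "x' = G * m' / r'" and "P = G'\<^sup>2 / r" and "P' = G\<^sup>2 / r'"
    define S where "S = G\<^sup>2 * (1 / h - 1 / r')"
    define Q where "Q = (g\<^sup>2 + 1) / h"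
    have c: "c \<ge> 0" using close by linarith
    have h_ge: "h > 0" "sqrt \<beta>2 \<le> h" using r_h[OF *] by (simp_all only: folds)
    have Gg: "G * g / h = A + D1" using h_ge by (simp add: A_def D1_def diff_divide_distrib)
    have gg: "Q \<le> D2 + s * A + 1 / sqrt \<beta>2"
    proof -
      have "1 / h \<le> 1 / sqrt \<beta>2" by (intro divide_left_mono mult_pos_pos h_ge sqrt_beta2) auto
      then show ?thesis by (simp add: Q_def A_def D2_def add_divide_distrib diff_divide_distrib)
    qed
    have v'pos: "v' > 0" using v beta2 by (simp add: v' add_pos_nonneg)
    have "m'\<^sup>2 \<le> mratio\<^sup>2 * v'"
      using momentum_sq_le[OF beta1_pos beta1_sq_less beta2(2) mratio_sq m] by (simp add: m' v')
    also have "\<dots> = (mratio * sqrt v')\<^sup>2" using v'pos by (simp add: power_mult_distrib)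
    finally have m'_le: "\<bar>m'\<bar> \<le> mratio * sqrt v'"
      using mratio_pos v'pos abs_le_square_iff[of m' "mratio * sqrt v'"] by simp
    have 1: "x' \<ge> b * (A + D1) + \<rho> * x - \<rho> * c * mratio - b * (Q / (2 * s) + k * S)"
    proof -
      have "x' \<ge> b * (A + D1) + \<rho> * x - \<rho> * c * mratio
          - b * (q * \<bar>G\<bar> * (sqrt (1 - \<beta>2) * (g\<^sup>2 + 1) / (r' + h)) / h)"
        using drift_raw[OF *] by (simp only: folds b_def[symmetric] x_def x'_def Gg)
      moreover have "b * (q * \<bar>G\<bar> * (sqrt (1 - \<beta>2) * (g\<^sup>2 + 1) / (r' + h)) / h) \<le> b * (Q / (2 * s) + k * S)"
        using young_loss[OF *] pos by (intro mult_left_mono) (simp_all only: folds Q_def k_def S_def less_imp_le)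
      ultimately show ?thesis by linarith
    qed
    have 2: "k * S \<le> A / 4 + k * (P - P') + k * (c\<^sup>2 / \<epsilon>)"
    proof -
      have "S \<le> (1 - sqrt \<beta>2 + \<epsilon>) * A + (P - P') + c\<^sup>2 / \<epsilon>"
        using telescoping_bound[OF * pos(2)] by (simp only: folds S_def A_def P_def P'_def)
      then have "k * S \<le> k * ((1 - sqrt \<beta>2 + \<epsilon>) * A + (P - P') + c\<^sup>2 / \<epsilon>)"
        using pos by (intro mult_left_mono) auto
      also have "\<dots> = (k * (1 - sqrt \<beta>2 + \<epsilon>)) * A + k * (P - P') + k * (c\<^sup>2 / \<epsilon>)"
        by (simp add: distrib_left)
      also have "(k * (1 - sqrt \<beta>2 + \<epsilon>)) * A \<le> (1 / 4) * A"
      proof (rule mult_right_mono)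
        have "k * \<epsilon> = 1 / 8" using q_pos pos(8) by (simp add: k_def \<epsilon>_def)
        moreover have "k * (1 - sqrt \<beta>2) \<le> 1 / 8"
          using telescoping_loss_le unfolding k_def by (simp only: times_divide_eq_left)
        ultimately show "k * (1 - sqrt \<beta>2 + \<epsilon>) \<le> 1 / 4" by (simp only: distrib_left)
        show "0 \<le> A" using h_ge by (simp add: A_def)
      qed
      finally show ?thesis by simp
    qed
    have Q: "Q / (2 * s) \<le> D2 / (2 * s) + A / 2 + 1 / sqrt \<beta>2 / (2 * s)"
      using divide_right_mono[OF gg, of "2 * s"] pos(8) by (simp add: add_divide_distrib)
    have "b * (Q / (2 * s) + k * S)
        \<le> b * (D2 / (2 * s) + A / 2 + 1 / sqrt \<beta>2 / (2 * s) + (A / 4 + k * (P - P') + k * (c\<^sup>2 / \<epsilon>)))"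
      using Q 2 pos by (intro mult_left_mono add_mono) auto
    then have 3: "x' \<ge> b * A / 4 + b * D1 + \<rho> * x - b * (D2 / (2 * s)) - b * k * (P - P')
        - (b * (1 / sqrt \<beta>2 / (2 * s)) + b * k * (c\<^sup>2 / \<epsilon>) + \<rho> * \<bar>c\<bar> * mratio)"
      using 1 c by (simp add: algebra_simps)
    have "x' \<le> y + \<epsilon>' * A + mratio\<^sup>2 / (4 * \<epsilon>' * sqrt \<beta>2)"
      using regularisation_loss[OF * v'pos m'_le pos(3)] by (simp only: folds x'_def y_def A_def)
    then have "(1 - \<rho>) * x' \<le> (1 - \<rho>) * (y + \<epsilon>' * A + mratio\<^sup>2 / (4 * \<epsilon>' * sqrt \<beta>2))"
      using rho by (intro mult_left_mono) auto
    also have "\<dots> = (1 - \<rho>) * y + b * A / 8 + (1 - \<rho>) * (mratio\<^sup>2 / (4 * \<epsilon>' * sqrt \<beta>2))"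
    proof -
      have "x * (b / (8 * x)) = b / 8" if "x \<noteq> 0" for x using that by simp
      from this[of "1 - \<rho>"] have "(1 - \<rho>) * \<epsilon>' = b / 8" using rho unfolding \<epsilon>'_def by linarith
      then have "(1 - \<rho>) * (\<epsilon>' * A) = b * A / 8" by (metis mult.assoc times_divide_eq_left)
      then show ?thesis by (simp only: distrib_left)
    qed
    finally have 4: "(1 - \<rho>) * x' \<le> (1 - \<rho>) * y + b * A / 8 + (1 - \<rho>) * (mratio\<^sup>2 / (4 * \<epsilon>' * sqrt \<beta>2))" .
    \<comment> \<open>The recursion between \<open>x\<close> and \<open>x'\<close> is split by
      \<open>x' - \<rho> * x = (1 - \<rho>) * x' + \<rho> * (x' - x)\<close>: the first part is
      compared with the true descent term \<open>y\<close>, the second telescopes.\<close>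
    have "b * A / 8 \<le> (1 - \<rho>) * y + \<rho> * (x' - x) - b * D1 + b * (D2 / (2 * s)) + b * k * (P - P') + K"
      using 3 4 unfolding K_def left_diff_distrib right_diff_distrib by linarith
    then have "8 / b * (b * A / 8) \<le> 8 / b * ((1 - \<rho>) * y + \<rho> * (x' - x) - b * D1 + b * (D2 / (2 * s)) + b * k * (P - P') + K)"
      using pos by (intro mult_left_mono) auto
    then have 5: "A \<le> 8 / b * (1 - \<rho>) * y + 8 / b * \<rho> * (x' - x) - 8 * D1 + 4 / s * D2 + 8 * k * (P - P') + 8 / b * K"
      using pos(1) by (simp add: algebra_simps add_divide_distrib diff_divide_distrib)
    have "(1 - sqrt \<beta>2) * r \<le> r - r' + (1 - \<beta>2) / 2 * Q"
      using denominator_growth[OF *] by (simp only: folds Q_def)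
    also have "\<dots> \<le> r - r' + (1 - \<beta>2) / 2 * (D2 + s * A + 1 / sqrt \<beta>2)"
      using gg beta2 by (intro add_left_mono mult_left_mono) auto
    finally have 6: "a * ((1 - sqrt \<beta>2) * r) \<le> a * (r - r' + (1 - \<beta>2) / 2 * (D2 + s * A + 1 / sqrt \<beta>2))"
      using pos by (intro mult_left_mono) auto
    have "a * ((1 - sqrt \<beta>2) * r) = r / 2"
    proof -
      have "1 / (2 * x) * (x * r) = r / 2" if "x \<noteq> 0" for x using that by simp
      from this[of "1 - sqrt \<beta>2"] show ?thesis using sqrt_beta2 unfolding a_def by linarith
    qed
    from 6[unfolded this]
    have "r / 2 \<le> a * (r - r' + (1 - \<beta>2) / 2 * (D2 + s * A + 1 / sqrt \<beta>2))" .
    moreover have "\<bar>G\<bar> \<le> A / 2 + r / 2"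
      using abs_le_quadratic[OF *] by (simp only: folds A_def add_divide_distrib)
    ultimately have "\<bar>G\<bar> \<le> A / 2 + a * (r - r' + (1 - \<beta>2) / 2 * (D2 + s * A + 1 / sqrt \<beta>2))"
      by (rule order_trans[rotated, OF add_left_mono])
    also have "\<dots> = a1 * A + a * (r - r') + a * ((1 - \<beta>2) / 2) * D2 + a * ((1 - \<beta>2) / 2) * (1 / sqrt \<beta>2)"
      unfolding a1_def by (simp only: distrib_left distrib_right mult.assoc)
    also have "a1 * A \<le> a1 * (8 / b * (1 - \<rho>) * y + 8 / b * \<rho> * (x' - x) - 8 * D1 + 4 / s * D2 + 8 * k * (P - P') + 8 / b * K)"
      using 5 pos by (intro mult_left_mono) auto
    finally show "\<bar>G\<bar> \<le> a1 * (8 / b * (1 - \<rho>)) * (G * m' / sqrt v') - a1 * 8 * ((G * g - G\<^sup>2) / h)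
        + (a1 * (4 / s) + a * ((1 - \<beta>2) / 2)) * ((g\<^sup>2 - s * G\<^sup>2) / h)
        + (a1 * (8 / b * K) + a * ((1 - \<beta>2) / 2) * (1 / sqrt \<beta>2))
        + (a1 * (8 / b * \<rho>) * (G * m' / sqrt (v' + 1)) - a1 * (8 * k) * (G\<^sup>2 / sqrt (v' + 1)) - a * sqrt (v' + 1))
        - (a1 * (8 / b * \<rho>) * (G' * m / sqrt (v + 1)) - a1 * (8 * k) * (G'\<^sup>2 / sqrt (v + 1)) - a * sqrt (v + 1))"
      unfolding folds y_def[symmetric] D1_def[symmetric] D2_def[symmetric] x_def[symmetric]
        x'_def[symmetric] P_def[symmetric] P'_def[symmetric]
      by (simp only: distrib_left distrib_right left_diff_distrib right_diff_distrib mult.assoc) linarith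
  qed (use pos rho beta2 sqrt_beta2 in \<open>auto intro!: mult_nonneg_nonneg add_nonneg_nonneg\<close>)
qed

end

section \<open>Trajectories\<close>

lemma vec_power2_nth [simp]: "((x :: real^'d::finite)\<^sup>2) $ i = (x $ i)\<^sup>2"
  by (simp add: power2_eq_square)

lemma vec_powr_minus_half_nth:
  "v $ i > 0 \<Longrightarrow> vec_powr v (-1/2) $ i = 1 / sqrt (v $ i)"
  by (simp add: vec_powr_def powr_minus_divide powr_half_sqrt)

lemma abs_grad_diff_le:
  fixes f :: "real^'d::finite \<Rightarrow> real"
  assumes "\<And>x y. norm (grad f x - grad f y) \<le> L * norm (x - y)"
  shows "\<bar>grad f x $ i - grad f y $ i\<bar> \<le> L * norm (x - y)"
  using component_le_norm_cart[of "grad f x - grad f y" i] assms[of x y] by simp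

context adam_parameters
begin

context
  fixes \<alpha> :: real and w1 v0 :: "real^'d::finite" and g m v w :: "nat \<Rightarrow> real^'d"
  assumes \<alpha>: "\<alpha> > 0" and v0: "\<And>i. v0 $ i > 0"
    and iterates: "adam_iterates \<alpha> \<beta>1 \<beta>2 w1 v0 g m v w"
begin

lemma adam_init: "w 1 = w1" "m 0 = 0" "v 0 = v0"
  using iterates by (auto simp: adam_iterates_def)

lemma adam_step:
  assumes "k \<ge> 1"
  shows "m k $ i = \<beta>1 * m (k - 1) $ i + (1 - \<beta>1) * g k $ i"
    and "v k $ i = \<beta>2 * v (k - 1) $ i + (1 - \<beta>2) * (g k $ i)\<^sup>2"
    and "w (k + 1) = w k - \<alpha> *\<^sub>R (m k * vec_powr (v k) (-1/2))"
proof -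
  have "m k = \<beta>1 *\<^sub>R m (k - 1) + (1 - \<beta>1) *\<^sub>R g k"
    and "v k = \<beta>2 *\<^sub>R v (k - 1) + (1 - \<beta>2) *\<^sub>R (g k)\<^sup>2"
    and "w (k + 1) = w k - \<alpha> *\<^sub>R (m k * vec_powr (v k) (-1/2))"
    using iterates assms by (auto simp: adam_iterates_def)
  then show "m k $ i = \<beta>1 * m (k - 1) $ i + (1 - \<beta>1) * g k $ i"
    and "v k $ i = \<beta>2 * v (k - 1) $ i + (1 - \<beta>2) * (g k $ i)\<^sup>2"
    and "w (k + 1) = w k - \<alpha> *\<^sub>R (m k * vec_powr (v k) (-1/2))"
    by simp_all
qed

lemma v_pos: "v k $ i > 0"
proof (induction k)
  case 0
  then show ?case using v0 by (simp add: adam_init)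
next
  case (Suc k)
  then show ?case using adam_step(2)[of "Suc k" i] beta2 by (simp add: add_pos_nonneg)
qed

lemma m_sq_le: "(m k $ i)\<^sup>2 \<le> mratio\<^sup>2 * v k $ i"
proof (induction k)
  case 0
  then show ?case using v0[of i] by (simp add: adam_init less_imp_le)
next
  case (Suc k)
  show ?case
    using momentum_sq_le[OF beta1_pos beta1_sq_less beta2(2) mratio_sq Suc, of "g (Suc k) $ i"]
      adam_step(1,2)[of "Suc k" i] by simp
qed

lemma abs_m_le: "\<bar>m k $ i\<bar> \<le> mratio * sqrt (v k $ i)"
proof -
  have "(m k $ i)\<^sup>2 \<le> (mratio * sqrt (v k $ i))\<^sup>2"
    using m_sq_le[of k i] v_pos[of k i] by (simp add: power_mult_distrib)
  then show ?thesis
    using mratio_pos v_pos[of k i] abs_le_square_iff[of "m k $ i" "mratio * sqrt (v k $ i)"] by simp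
qed

lemma step_nth: "k \<ge> 1 \<Longrightarrow> (w (k + 1) - w k) $ i = - \<alpha> * (m k $ i / sqrt (v k $ i))"
  using vec_powr_minus_half_nth[OF v_pos, of k i] by (simp only: adam_step(3)) simp

text \<open>Each coordinate moves by at most \<open>\<alpha> * mratio\<close>, however large the
  gradient. With Lipschitz smoothness this bounds the change of the gradient per iteration, as
  required for \<open>c\<close> in \<open>one_step_bound\<close>.\<close>

lemma step_norm_le:
  assumes "k \<ge> 1"
  shows "norm (w (k + 1) - w k) \<le> real CARD('d) * (\<alpha> * mratio)"
proof -
  have "norm (w (k + 1) - w k) \<le> (\<Sum>i\<in>UNIV. \<bar>(w (k + 1) - w k) $ i\<bar>)"
    by (rule norm_le_l1_cart)
  also have "\<dots> \<le> (\<Sum>i\<in>(UNIV :: 'd set). \<alpha> * mratio)"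
  proof (rule sum_mono)
    fix i
    have "\<bar>m k $ i\<bar> / sqrt (v k $ i) \<le> mratio"
      using abs_m_le[of k i] v_pos[of k i] by (simp add: pos_divide_le_eq)
    then have "\<alpha> * (\<bar>m k $ i\<bar> / sqrt (v k $ i)) \<le> \<alpha> * mratio"
      using \<alpha> by (intro mult_left_mono) auto
    then show "\<bar>(w (k + 1) - w k) $ i\<bar> \<le> \<alpha> * mratio"
      unfolding step_nth[OF assms] using \<alpha> v_pos[of k i] by (simp add: abs_mult)
  qed
  finally show ?thesis by simp
qed

end

text \<open>Sums \<open>one_step_bound\<close> over coordinates and iterations for an arbitrary
  gradient sequence \<open>g\<close>. The constants are fixed before the trajectory, so the same
  inequality holds at every sample point; the two sums with \<open>c2\<close> and \<open>c3\<close>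
  are left for the expectation.\<close>

lemma path_bound:
  fixes f :: "real^'d::finite \<Rightarrow> real" and w1 v0 :: "real^'d"
  assumes diff: "\<And>x. f differentiable (at x)"
    and lip: "\<And>x y. norm (grad f x - grad f y) \<le> L * norm (x - y)" and L: "L \<ge> 0"
    and bdd: "\<And>x. f x \<ge> fmin"
    and \<alpha>: "\<alpha> > 0" and v0: "\<And>i. v0 $ i > 0"
  obtains C c2 c3 where "0 \<le> C" "0 \<le> c2" "0 \<le> c3"
    and "\<And>g m v w K. adam_iterates \<alpha> \<beta>1 \<beta>2 w1 v0 g m v w \<Longrightarrow>
      (\<Sum>k=1..K. \<Sum>i\<in>UNIV. \<bar>grad f (w k) $ i\<bar>) \<le> C * (1 + real K)
        - c2 * (\<Sum>k=1..K. \<Sum>i\<in>UNIV. (grad f (w k) $ i * g k $ i - (grad f (w k) $ i)\<^sup>2)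
            / (sqrt \<beta>2 * sqrt (v (k - 1) $ i + 1)))
        + c3 * (\<Sum>k=1..K. \<Sum>i\<in>UNIV. ((g k $ i)\<^sup>2 - s * (grad f (w k) $ i)\<^sup>2)
            / (sqrt \<beta>2 * sqrt (v (k - 1) $ i + 1)))"
proof -
  define D where "D = real CARD('d) * (\<alpha> * mratio)"
  define c where "c = L * D"
  have D: "D \<ge> 0" using \<alpha> mratio_pos by (simp add: D_def)
  have c: "c \<ge> 0" using D L by (simp add: c_def)
  obtain c1 c2 c3 c4 cx cp cr :: real
    where nonneg: "0 \<le> c1" "0 \<le> c2" "0 \<le> c3" "0 \<le> c4" "0 \<le> cx" "0 \<le> cp" "0 \<le> cr"
    and bound: "\<And>G G' g m v m' v' h. v > 0 \<Longrightarrow> m\<^sup>2 \<le> mratio\<^sup>2 * v \<Longrightarrow> \<bar>G - G'\<bar> \<le> c \<Longrightarrow>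
      m' = \<beta>1 * m + (1 - \<beta>1) * g \<Longrightarrow> v' = \<beta>2 * v + (1 - \<beta>2) * g\<^sup>2 \<Longrightarrow>
      h = sqrt \<beta>2 * sqrt (v + 1) \<Longrightarrow>
      \<bar>G\<bar> \<le> c1 * (G * m' / sqrt v') - c2 * ((G * g - G\<^sup>2) / h) + c3 * ((g\<^sup>2 - s * G\<^sup>2) / h) + c4
        + (cx * (G * m' / sqrt (v' + 1)) - cp * (G\<^sup>2 / sqrt (v' + 1)) - cr * sqrt (v' + 1))
        - (cx * (G' * m / sqrt (v + 1)) - cp * (G'\<^sup>2 / sqrt (v + 1)) - cr * sqrt (v + 1))"
    apply (rule one_step_bound[of c])
    subgoal premises p by (rule p(1)) (fact p)+
    done
  define Y0 where "Y0 = (f w1 - fmin) / \<alpha>"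
  define P0 where "P0 i = cx * (\<bar>grad f w1 $ i\<bar> * mratio) + cp * (grad f w1 $ i)\<^sup>2 / sqrt (v0 $ i + 1)
    + cr * sqrt (v0 $ i + 1)" for i
  define C where "C = c1 * (Y0 + L * D\<^sup>2 / \<alpha>) + (\<Sum>i\<in>UNIV. P0 i + cx * (c * mratio) + c4)"
  have Y0: "Y0 \<ge> 0" using bdd[of w1] \<alpha> by (simp add: Y0_def)
  have P0: "P0 i \<ge> 0" for i
    unfolding P0_def using nonneg mratio_pos v0[of i]
    by (intro add_nonneg_nonneg mult_nonneg_nonneg divide_nonneg_nonneg) auto
  show thesis
  proof (rule that[of C c2 c3])
    show "0 \<le> C" unfolding C_def
      using nonneg Y0 P0 L D \<alpha> c mratio_pos
      by (intro add_nonneg_nonneg mult_nonneg_nonneg sum_nonneg divide_nonneg_nonneg) auto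
    fix g m v w K
    assume it: "adam_iterates \<alpha> \<beta>1 \<beta>2 w1 v0 g m v w"
    note facts = \<alpha> v0 it
    \<comment> \<open>Iteration \<open>1\<close> has no predecessor. The convention
      \<open>G 0 = G 1\<close> makes its gradient difference vanish, and \<open>m 0 = 0\<close>
      removes the momentum term there.\<close>
    define G where "G k i = grad f (w (max k 1)) $ i" for k i
    have G_eq: "G k i = grad f (w k) $ i" if "k \<ge> 1" for k i
      using that by (simp add: G_def max_def)
    have G_0: "G 0 i = grad f w1 $ i" for i
      by (simp add: G_def adam_init[OF facts, simplified])
    have G_diff: "\<bar>G k i - G (k - 1) i\<bar> \<le> c" if "k \<ge> 1" for k i
    proof (cases "k = 1")
      case True
      then show ?thesis using c by (simp add: G_def)
    next
      case False
      then have k: "k - 1 \<ge> 1" "k - 1 + 1 = k" using that by auto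
      have "\<bar>G k i - G (k - 1) i\<bar> \<le> L * norm (w k - w (k - 1))"
        unfolding G_eq[OF that] G_eq[OF k(1)] by (rule abs_grad_diff_le[OF lip])
      also have "\<dots> \<le> c"
        unfolding c_def using step_norm_le[OF facts k(1)] L k
        by (intro mult_left_mono) (auto simp: D_def)
      finally show ?thesis .
    qed
    \<comment> \<open>Linear growth of the gradients suffices, since it is used only for the final
      value of the potential and not for each summand.\<close>
    have G_growth: "\<bar>G k i\<bar> \<le> \<bar>G 0 i\<bar> + c * k" for k i
    proof (induction k)
      case (Suc k)
      then show ?case using G_diff[of "Suc k" i] by (simp add: algebra_simps)
    qed simp
    define y where "y k i = G k i * m k $ i / sqrt (v k $ i)" for k i
    define D1 where "D1 k i = (G k i * g k $ i - (G k i)\<^sup>2) / (sqrt \<beta>2 * sqrt (v (k - 1) $ i + 1))" for k i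
    define D2 where "D2 k i = ((g k $ i)\<^sup>2 - s * (G k i)\<^sup>2) / (sqrt \<beta>2 * sqrt (v (k - 1) $ i + 1))" for k i
    define pot where "pot k i = cx * (G k i * m k $ i / sqrt (v k $ i + 1))
      - cp * ((G k i)\<^sup>2 / sqrt (v k $ i + 1)) - cr * sqrt (v k $ i + 1)" for k i
    have step: "\<bar>G k i\<bar> \<le> c1 * y k i - c2 * D1 k i + c3 * D2 k i + c4 + (pot k i - pot (k - 1) i)"
      if "k \<ge> 1" for k i
      using bound[OF v_pos[OF facts] m_sq_le[OF facts] G_diff[OF that] adam_step(1,2)[OF facts that] refl]
      unfolding y_def D1_def D2_def pot_def by (simp only: add_diff_eq)
    \<comment> \<open>At \<open>K\<close> only the momentum term can be positive. At
      \<open>0\<close> that term vanishes, so subtracting the potential leaves the other two terms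
      with positive sign, as in \<open>P0\<close>.\<close>
    have pot: "pot K i - pot 0 i \<le> P0 i + cx * (c * mratio) * K" for i
    proof -
      have vp: "v K $ i > 0" by (rule v_pos[OF facts])
      have "\<bar>m K $ i\<bar> / sqrt (v K $ i + 1) \<le> mratio"
      proof -
        have "\<bar>m K $ i\<bar> \<le> mratio * sqrt (v K $ i)" by (rule abs_m_le[OF facts])
        also have "\<dots> \<le> mratio * sqrt (v K $ i + 1)" using mratio_pos by simp
        finally show ?thesis using vp by (simp add: pos_divide_le_eq)
      qed
      then have "\<bar>G K i\<bar> * (\<bar>m K $ i\<bar> / sqrt (v K $ i + 1)) \<le> (\<bar>G 0 i\<bar> + c * K) * mratio"
        using vp G_growth[of K i] c by (intro mult_mono) auto
      then have "G K i * m K $ i / sqrt (v K $ i + 1) \<le> (\<bar>G 0 i\<bar> + c * K) * mratio"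
        using vp abs_ge_self[of "G K i * m K $ i / sqrt (v K $ i + 1)"]
        by (simp add: abs_mult)
      then have "cx * (G K i * m K $ i / sqrt (v K $ i + 1)) \<le> cx * ((\<bar>G 0 i\<bar> + c * K) * mratio)"
        using nonneg by (intro mult_left_mono) auto
      moreover have "0 \<le> cp * ((G K i)\<^sup>2 / sqrt (v K $ i + 1))" "0 \<le> cr * sqrt (v K $ i + 1)"
        using nonneg vp by auto
      ultimately have "pot K i \<le> cx * ((\<bar>G 0 i\<bar> + c * K) * mratio)"
        unfolding pot_def by linarith
      then show ?thesis
        by (simp add: pot_def[of 0] P0_def adam_init[OF facts] G_0 algebra_simps)
    qed
    have y_sum: "(\<Sum>k=1..K. \<Sum>i\<in>UNIV. y k i) \<le> Y0 + L * D\<^sup>2 / \<alpha> * K"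
    proof -
      have desc: "\<alpha> * (\<Sum>i\<in>UNIV. y k i) \<le> f (w k) - f (w (k + 1)) + L * D\<^sup>2" if "k \<ge> 1" for k
      proof -
        have "grad f (w k) \<bullet> (w (k + 1) - w k) = - \<alpha> * (\<Sum>i\<in>UNIV. y k i)"
          by (simp only: inner_vec_def step_nth[OF facts that] y_def G_eq[OF that] sum_distrib_left)
            (simp add: mult_ac)
        moreover have "L * (norm (w (k + 1) - w k))\<^sup>2 \<le> L * D\<^sup>2"
          using step_norm_le[OF facts that] L unfolding D_def
          by (intro mult_left_mono power_mono) auto
        ultimately show ?thesis
          using descent_inequality[OF diff lip L, of "w (k + 1)" "w k"] by linarith
      qed
      have "\<alpha> * (\<Sum>k=1..K. \<Sum>i\<in>UNIV. y k i) = (\<Sum>k=1..K. \<alpha> * (\<Sum>i\<in>UNIV. y k i))"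
        by (rule sum_distrib_left)
      also have "\<dots> \<le> (\<Sum>k=1..K. f (w k) - f (w (k + 1)) + L * D\<^sup>2)"
        using desc by (intro sum_mono) auto
      also have "\<dots> = f (w 1) - f (w (K + 1)) + K * (L * D\<^sup>2)"
        by (induction K) (simp_all add: algebra_simps)
      also have "\<dots> \<le> f w1 - fmin + K * (L * D\<^sup>2)"
        using bdd[of "w (K + 1)"] by (simp add: adam_init[OF facts, simplified])
      finally have "(\<Sum>k=1..K. \<Sum>i\<in>UNIV. y k i) \<le> (f w1 - fmin + K * (L * D\<^sup>2)) / \<alpha>"
        using \<alpha> by (simp add: pos_le_divide_eq mult.commute)
      then show ?thesis by (simp add: Y0_def add_divide_distrib mult_ac)
    qed
    have "(\<Sum>k=1..K. \<Sum>i\<in>UNIV. \<bar>G k i\<bar>)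
        \<le> (\<Sum>k=1..K. \<Sum>i\<in>UNIV. c1 * y k i - c2 * D1 k i + c3 * D2 k i + c4 + (pot k i - pot (k - 1) i))"
      using step by (intro sum_mono) auto
    also have "\<dots> = c1 * (\<Sum>k=1..K. \<Sum>i\<in>UNIV. y k i) - c2 * (\<Sum>k=1..K. \<Sum>i\<in>UNIV. D1 k i)
        + c3 * (\<Sum>k=1..K. \<Sum>i\<in>UNIV. D2 k i) + (\<Sum>i\<in>(UNIV::'d set). c4) * K
        + (\<Sum>k=1..K. \<Sum>i\<in>UNIV. pot k i - pot (k - 1) i)"
      by (simp add: sum.distrib sum_subtractf sum_distrib_left mult_ac)
    also have "(\<Sum>k=1..K. \<Sum>i\<in>UNIV. pot k i - pot (k - 1) i) = (\<Sum>i\<in>UNIV. pot K i - pot 0 i)"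
    proof -
      have "(\<Sum>k=1..K. pot k i - pot (k - 1) i) = pot K i - pot 0 i" for i
        using sum_telescope''[of 0 K "\<lambda>k. pot k i"] by simp
      then show ?thesis by (subst sum.swap) simp
    qed
    also have "\<dots> \<le> (\<Sum>i\<in>UNIV. P0 i + cx * (c * mratio) * K)"
      using pot by (intro sum_mono) auto
    also have "c1 * (\<Sum>k=1..K. \<Sum>i\<in>UNIV. y k i) \<le> c1 * (Y0 + L * D\<^sup>2 / \<alpha> * K)"
      using y_sum nonneg by (intro mult_left_mono) auto
    finally have "(\<Sum>k=1..K. \<Sum>i\<in>UNIV. \<bar>G k i\<bar>) \<le>
        (c1 * (Y0 + L * D\<^sup>2 / \<alpha> * K) + (\<Sum>i\<in>(UNIV::'d set). c4) * K + (\<Sum>i\<in>UNIV. P0 i + cx * (c * mratio) * K))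
        - c2 * (\<Sum>k=1..K. \<Sum>i\<in>UNIV. D1 k i) + c3 * (\<Sum>k=1..K. \<Sum>i\<in>UNIV. D2 k i)"
      by (simp only: algebra_simps)
    also have "c1 * (Y0 + L * D\<^sup>2 / \<alpha> * K) + (\<Sum>i\<in>(UNIV::'d set). c4) * K
        + (\<Sum>i\<in>UNIV. P0 i + cx * (c * mratio) * K) \<le> C * (1 + real K)"
    proof -
      have lin: "u + t * K \<le> (u + t) * (1 + real K)" if "u \<ge> 0" "t \<ge> 0" for u t :: real
        using that by (simp add: algebra_simps)
      have "c1 * (Y0 + L * D\<^sup>2 / \<alpha> * K) \<le> c1 * ((Y0 + L * D\<^sup>2 / \<alpha>) * (1 + real K))"
        using lin[of Y0 "L * D\<^sup>2 / \<alpha>"] Y0 L \<alpha> nonneg by (intro mult_left_mono) auto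
      moreover have "(\<Sum>i\<in>(UNIV::'d set). c4) * K + (\<Sum>i\<in>UNIV. P0 i + cx * (c * mratio) * K)
          = (\<Sum>i\<in>UNIV. P0 i + (cx * (c * mratio) + c4) * K)"
        by (simp add: sum.distrib algebra_simps)
      moreover have "\<dots> \<le> (\<Sum>i\<in>UNIV. (P0 i + (cx * (c * mratio) + c4)) * (1 + real K))"
        using lin P0 nonneg c mratio_pos by (intro sum_mono) auto
      ultimately show ?thesis
        by (simp add: C_def sum_distrib_right distrib_right add.assoc mult.assoc)
    qed
    finally show "(\<Sum>k=1..K. \<Sum>i\<in>UNIV. \<bar>grad f (w k) $ i\<bar>) \<le> C * (1 + real K)
        - c2 * (\<Sum>k=1..K. \<Sum>i\<in>UNIV. (grad f (w k) $ i * g k $ i - (grad f (w k) $ i)\<^sup>2)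
            / (sqrt \<beta>2 * sqrt (v (k - 1) $ i + 1)))
        + c3 * (\<Sum>k=1..K. \<Sum>i\<in>UNIV. ((g k $ i)\<^sup>2 - s * (grad f (w k) $ i)\<^sup>2)
            / (sqrt \<beta>2 * sqrt (v (k - 1) $ i + 1)))"
      by (simp add: D1_def D2_def G_eq)
  qed (use nonneg in auto)
qed

end

section \<open>Uniform sampling of batches\<close>

lemma card_subsets_containing:
  assumes "finite A" "i \<in> A" "b \<ge> 1"
  shows "card {S. S \<subseteq> A \<and> card S = b \<and> i \<in> S} = (card A - 1) choose (b - 1)"
proof -
  have "bij_betw (insert i) {T. T \<subseteq> A - {i} \<and> card T = b - 1} {S. S \<subseteq> A \<and> card S = b \<and> i \<in> S}"
  proof (rule bij_betw_byWitness[where f' = "\<lambda>S. S - {i}"])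
    show "insert i ` {T. T \<subseteq> A - {i} \<and> card T = b - 1} \<subseteq> {S. S \<subseteq> A \<and> card S = b \<and> i \<in> S}"
    proof clarify
      fix T assume T: "T \<subseteq> A - {i}" "card T = b - 1"
      then have "finite T" "i \<notin> T" using assms(1) finite_subset[of T "A - {i}"] by auto
      then show "insert i T \<subseteq> A \<and> card (insert i T) = b \<and> i \<in> insert i T"
        using T assms(2,3) by auto
    qed
    show "(\<lambda>S. S - {i}) ` {S. S \<subseteq> A \<and> card S = b \<and> i \<in> S} \<subseteq> {T. T \<subseteq> A - {i} \<and> card T = b - 1}"
      by (auto simp: card_Diff_singleton)
  qed auto
  then have "card {S. S \<subseteq> A \<and> card S = b \<and> i \<in> S} = card {T. T \<subseteq> A - {i} \<and> card T = b - 1}"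
    by (simp add: bij_betw_same_card)
  also have "\<dots> = (card A - 1) choose (b - 1)"
    using n_subsets[of "A - {i}" "b - 1"] assms by (simp add: card_Diff_singleton)
  finally show ?thesis .
qed

text \<open>Double counting: every \<open>i\<close> lies in
  \<open>(card A - 1) choose (b - 1)\<close> subsets of size \<open>b\<close>, and this number times
  \<open>card A\<close> equals \<open>b * (card A choose b)\<close>.\<close>

lemma average_over_subsets:
  fixes a :: "'i \<Rightarrow> real"
  assumes A: "finite A" and b: "1 \<le> b" "b \<le> card A"
  shows "(\<Sum>S | S \<subseteq> A \<and> card S = b. (\<Sum>i\<in>S. a i) / b) / (card A choose b) = (\<Sum>i\<in>A. a i) / card A"
proof -
  have fin: "finite {S. S \<subseteq> A \<and> card S = b}" using A by simp
  have "(\<Sum>S | S \<subseteq> A \<and> card S = b. \<Sum>i\<in>S. a i)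
      = (\<Sum>S | S \<subseteq> A \<and> card S = b. \<Sum>i\<in>A. if i \<in> S then a i else 0)"
    unfolding sum.inter_restrict[OF A, symmetric]
    by (intro sum.cong refl) (auto intro: arg_cong[where f = "sum a"])
  also have "\<dots> = (\<Sum>i\<in>A. \<Sum>S | S \<subseteq> A \<and> card S = b. if i \<in> S then a i else 0)"
    by (rule sum.swap)
  also have "\<dots> = (\<Sum>i\<in>A. real ((card A - 1) choose (b - 1)) * a i)"
  proof (rule sum.cong[OF refl])
    fix i assume i: "i \<in> A"
    have "(\<Sum>S | S \<subseteq> A \<and> card S = b. if i \<in> S then a i else 0)
        = (\<Sum>S | S \<subseteq> A \<and> card S = b \<and> i \<in> S. a i)"
      using fin by (simp add: sum.inter_filter[symmetric] conj_assoc)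
    then show "(\<Sum>S | S \<subseteq> A \<and> card S = b. if i \<in> S then a i else 0) = real ((card A - 1) choose (b - 1)) * a i"
      using card_subsets_containing[OF A i b(1)] by simp
  qed
  also have "\<dots> = real ((card A - 1) choose (b - 1)) * (\<Sum>i\<in>A. a i)"
    by (simp add: sum_distrib_left)
  finally have sum: "(\<Sum>S | S \<subseteq> A \<and> card S = b. (\<Sum>i\<in>S. a i) / b)
      = real ((card A - 1) choose (b - 1)) * (\<Sum>i\<in>A. a i) / b"
    by (simp add: sum_divide_distrib[symmetric])
  have "real b * real (card A choose b) = real (card A) * real ((card A - 1) choose (b - 1))"
    using times_binomial_minus1_eq[of b "card A"] b by (metis of_nat_mult less_eq_Suc_le One_nat_def)
  moreover have "real (card A choose b) > 0" "real b > 0" "real (card A) > 0"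
    using b by simp_all
  ultimately show ?thesis
    unfolding sum by (simp add: field_simps)
qed

section \<open>Random batches and functions of the past\<close>

locale batch_process = prob_space M for M :: "'a measure" +
  fixes n :: nat and w0 :: "'a \<Rightarrow> real^'d::finite" and z :: "real^'d" and B :: "nat \<Rightarrow> 'a \<Rightarrow> nat set"
  assumes w0_const: "\<And>x. x \<in> space M \<Longrightarrow> w0 x = z"
    and sampling: "uniform_batch_sampling M n w0 B"
begin

abbreviation "F \<equiv> history M w0 B"

text \<open>
  Batches take finitely many values and the initial point is constant, so every function of
  \<open>B 1, \<dots>, B (k - 1)\<close> is automatically measurable with respect to \<open>F k\<close> and bounded.
\<close>

definition determined :: "nat \<Rightarrow> ('a \<Rightarrow> 'b) \<Rightarrow> bool" where
  "determined k f \<longleftrightarrow> (\<forall>x\<in>space M. \<forall>y\<in>space M. (\<forall>j. 1 \<le> j \<and> j < k \<longrightarrow> B j x = B j y) \<longrightarrow> f x = f y)"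

lemma finite_batches: "finite (batches n)"
  by (rule finite_subset[of _ "Pow {1..n}"]) (auto simp: batches_def)

lemma batch_measurable: "k \<ge> 1 \<Longrightarrow> B k \<in> measurable M (count_space (batches n))"
  using sampling by (simp add: uniform_batch_sampling_def)

lemma batch_in: "k \<ge> 1 \<Longrightarrow> x \<in> space M \<Longrightarrow> B k x \<in> batches n"
  using measurable_space[OF batch_measurable] by simp

lemma batch_vimage_sets:
  assumes "k \<ge> 1"
  shows "B k -` A \<inter> space M \<in> sets M"
proof -
  have "B k -` A \<inter> space M = B k -` (A \<inter> batches n) \<inter> space M"
    using batch_in[OF assms] by auto
  then show ?thesis
    using measurable_sets[OF batch_measurable[OF assms], of "A \<inter> batches n"] by simp
qed

lemma history_gen_subset:
  "{w0 -` A \<inter> space M |A. A \<in> sets borel} \<union> {B j -` A \<inter> space M |A j. 1 \<le> j \<and> j < k} \<subseteq> Pow (space M)"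
  by auto

lemma space_F [simp]: "space (F k) = space M"
  unfolding history_def by (rule space_measure_of[OF history_gen_subset])

lemma subalg: "subalgebra M (F k)"
proof -
  have "w0 -` A \<inter> space M \<in> sets M" for A
  proof -
    have "w0 -` A \<inter> space M = (if z \<in> A then space M else {})"
      using w0_const by auto
    then show ?thesis by simp
  qed
  then have "sets (F k) \<subseteq> sets M"
    unfolding history_def sets_measure_of[OF history_gen_subset]
    by (intro sets.sigma_sets_subset) (auto intro: batch_vimage_sets)
  then show ?thesis by (simp add: subalgebra_def)
qed

lemma finite_measure_subalgebra: "finite_measure_subalgebra M (F k)"
  by unfold_locales (rule subalg)

lemma batch_event_F: "1 \<le> j \<Longrightarrow> j < k \<Longrightarrow> {x \<in> space M. B j x = S} \<in> sets (F k)"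
proof -
  assume j: "1 \<le> j" "j < k"
  have "B j -` {S} \<inter> space M \<in> sets (F k)"
    unfolding history_def sets_measure_of[OF history_gen_subset]
    using j by (intro sigma_sets.Basic) auto
  also have "B j -` {S} \<inter> space M = {x \<in> space M. B j x = S}" by auto
  finally show ?thesis .
qed

text \<open>Restricting to the indices \<open>1..<k\<close> places the whole past in a finite
  product of copies of \<open>batches n\<close>.\<close>

definition past :: "nat \<Rightarrow> 'a \<Rightarrow> nat \<Rightarrow> nat set" where
  "past k x = restrict (\<lambda>j. B j x) {1..<k}"

lemma finite_past: "finite (past k ` space M)"
proof (rule finite_subset)
  show "past k ` space M \<subseteq> PiE {1..<k} (\<lambda>_. batches n)"
    using batch_in by (auto simp: past_def)
  show "finite (PiE {1..<k} (\<lambda>_. batches n))"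
    by (intro finite_PiE finite_batches) auto
qed

lemma determinedD:
  assumes "determined k f" "x \<in> space M" "y \<in> space M" "past k x = past k y"
  shows "f x = f y"
proof -
  have "B j x = B j y" if "1 \<le> j" "j < k" for j
    using fun_cong[OF assms(4), of j] that by (simp add: past_def)
  then show ?thesis using assms(1)[unfolded determined_def, rule_format, OF assms(2,3)] by blast
qed

lemma determined_finite:
  assumes "determined k f"
  shows "finite (f ` space M)"
proof -
  have "f ` space M \<subseteq> (\<lambda>\<tau>. f (SOME y. y \<in> space M \<and> past k y = \<tau>)) ` past k ` space M"
  proof
    fix r assume "r \<in> f ` space M"
    then obtain x where x: "x \<in> space M" "r = f x" by auto
    define y where "y = (SOME y. y \<in> space M \<and> past k y = past k x)"
    have "y \<in> space M \<and> past k y = past k x"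
      unfolding y_def by (rule someI[of _ x]) (use x in simp)
    then have "f x = f y" using determinedD[OF assms x(1), of y] by simp
    then show "r \<in> (\<lambda>\<tau>. f (SOME y. y \<in> space M \<and> past k y = \<tau>)) ` past k ` space M"
      using x by (auto simp: y_def)
  qed
  then show ?thesis using finite_past finite_subset by blast
qed

text \<open>The preimage of any set is a finite union of the events \<open>E \<tau>\<close> that
  prescribe all earlier batches, and each of these lies in the history.\<close>

lemma determined_measurable:
  assumes "determined k (f :: 'a \<Rightarrow> real)"
  shows "f \<in> borel_measurable (F k)"
proof (rule measurableI)
  fix A :: "real set"
  define E where "E \<tau> = {x \<in> space M. \<forall>j\<in>{1..<k}. B j x = \<tau> j}" for \<tau>
  have E: "E \<tau> \<in> sets (F k)" for \<tau>
    unfolding E_def using sets.sets_Collect_finite_All[of "{1..<k}" "F k" "\<lambda>j x. B j x = \<tau> j"] batch_event_F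
    by simp
  have "f -` A \<inter> space M = (\<Union>\<tau>\<in>past k ` (f -` A \<inter> space M). E \<tau>)"
  proof (intro equalityI subsetI)
    fix x assume "x \<in> f -` A \<inter> space M"
    then show "x \<in> (\<Union>\<tau>\<in>past k ` (f -` A \<inter> space M). E \<tau>)"
      by (auto simp: E_def past_def)
  next
    fix x assume "x \<in> (\<Union>\<tau>\<in>past k ` (f -` A \<inter> space M). E \<tau>)"
    then obtain y where y: "y \<in> space M" "f y \<in> A" "x \<in> E (past k y)" by auto
    then have "past k x = past k y" by (auto simp: E_def past_def fun_eq_iff)
    then have "f x = f y" using determinedD[OF assms, of x y] y by (simp add: E_def)
    then show "x \<in> f -` A \<inter> space M" using y by (simp add: E_def)
  qed
  moreover have "\<dots> \<in> sets (F k)"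
    using E finite_past[of k] by (intro sets.finite_UN) (auto elim: finite_subset[rotated])
  ultimately show "f -` A \<inter> space (F k) \<in> sets (F k)" by simp
qed simp

lemma determined_measurable_M: "determined k (f :: 'a \<Rightarrow> real) \<Longrightarrow> f \<in> borel_measurable M"
  by (rule measurable_from_subalg[OF subalg determined_measurable])

lemma determined_integrable:
  assumes "determined k (f :: 'a \<Rightarrow> real)"
  shows "integrable M f"
proof (rule integrable_const_bound[where B = "Max (abs ` f ` space M)"])
  show "AE x in M. norm (f x) \<le> Max (abs ` f ` space M)"
    using determined_finite[OF assms] by (intro AE_I2) (auto intro: Max_ge)
qed (rule determined_measurable_M[OF assms])

lemma determined_batch: "1 \<le> j \<Longrightarrow> j < k \<Longrightarrow> determined k (B j)"
  by (auto simp: determined_def)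

lemma determined_mono: "determined j f \<Longrightarrow> j \<le> k \<Longrightarrow> determined k f"
  unfolding determined_def by (meson less_le_trans)

lemma determined_app: "determined k f \<Longrightarrow> determined k (\<lambda>x. g (f x))"
  unfolding determined_def by metis

lemma determined_app2: "determined k f \<Longrightarrow> determined k f' \<Longrightarrow> determined k (\<lambda>x. g (f x) (f' x))"
  unfolding determined_def by metis

lemma determined_sum: "(\<And>i. i \<in> I \<Longrightarrow> determined k (f i)) \<Longrightarrow> determined k (\<lambda>x. \<Sum>i\<in>I. f i x)"
  unfolding determined_def by (intro ballI impI sum.cong refl) blast

text \<open>The sampling rule speaks of conditional expectations. Integrating it against a weight
  determined by the past removes the conditioning on both sides.\<close>

lemma integral_batch_indicator:
  assumes k: "k \<ge> 1" and S: "S \<in> batches n" and \<psi>: "determined k (\<psi> :: 'a \<Rightarrow> real)"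
  shows "(\<integral>x. \<psi> x * indicator {y. B k y = S} x \<partial>M)
    = (\<integral>x. \<psi> x * indicator {y. card (B k y) = card S} x / real (n choose card S) \<partial>M)"
proof -
  interpret finite_measure_subalgebra M "F k" by (rule finite_measure_subalgebra)
  \<comment> \<open>The index is \<open>Suc k\<close> because the batch \<open>B k\<close> itself
    enters only the next history.\<close>
  have det: "determined (Suc k) (indicator {y. P (B k y)} :: 'a \<Rightarrow> real)" for P
    using k by (auto simp: determined_def indicator_def)
  have int: "integrable M (\<lambda>x. \<psi> x * indicator {y. P (B k y)} x)" for P
    by (rule determined_integrable[of "Suc k"])
      (intro determined_app2[where g = "(*)"] det determined_mono[OF \<psi>], simp)
  note cond = real_cond_exp_intg(2)[OF int determined_measurable[OF \<psi>] determined_measurable_M[OF det]]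
  have "AE x in M. real_cond_exp M (F k) (indicator {y. B k y = S}) x =
        real_cond_exp M (F k) (indicator {y. card (B k y) = card S}) x / real (n choose card S)"
    using sampling k S by (auto simp: uniform_batch_sampling_def)
  then have "(\<integral>x. \<psi> x * real_cond_exp M (F k) (indicator {y. B k y = S}) x \<partial>M)
      = (\<integral>x. \<psi> x * real_cond_exp M (F k) (indicator {y. card (B k y) = card S}) x / real (n choose card S) \<partial>M)"
    by (intro integral_cong_AE borel_measurable_times borel_measurable_divide borel_measurable_const
        borel_measurable_cond_exp2 determined_measurable_M[OF \<psi>]) auto
  then show ?thesis
    using cond[of "\<lambda>T. T = S"] cond[of "\<lambda>T. card T = card S"] by simp
qed

text \<open>Decompose by the value \<open>S\<close> of the batch and replace each event
  \<open>B k = S\<close> by its share of the event that the size is \<open>card S\<close>. At each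
  sample point only the sets of the size actually drawn contribute, and their averages have mean
  \<open>(\<Sum>i=1..n. a i x) / n\<close>; hence the size may be random.\<close>

lemma batch_average_unbiased:
  assumes k: "k \<ge> 1" and \<psi>: "determined k (\<psi> :: 'a \<Rightarrow> real)"
    and a: "\<And>i. determined k (a i :: 'a \<Rightarrow> real)"
  shows "(\<integral>x. \<psi> x * ((\<Sum>i\<in>B k x. a i x) / card (B k x)) \<partial>M)
    = (\<integral>x. \<psi> x * ((\<Sum>i=1..n. a i x) / n) \<partial>M)"
proof -
  define avg where "avg S x = (\<Sum>i\<in>S. a i x) / card S" for S x
  have det_avg: "determined k (\<lambda>x. \<psi> x * avg S x)" for S
    unfolding avg_def
    by (rule determined_app2[where g = "\<lambda>p q. p * (q / card S)", OF \<psi> determined_sum]) (rule a)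
  have det_ind: "determined (Suc k) (indicator {y. P (B k y)} :: 'a \<Rightarrow> real)" for P
    using k by (auto simp: determined_def indicator_def)
  have int: "integrable M (\<lambda>x. \<psi> x * avg S x * indicator {y. P (B k y)} x)" for S P
    by (rule determined_integrable[of "Suc k"])
      (intro determined_app2[where g = "(*)"] det_ind determined_mono[OF det_avg], simp)
  have "(\<integral>x. \<psi> x * avg (B k x) x \<partial>M)
      = (\<integral>x. (\<Sum>S\<in>batches n. \<psi> x * avg S x * indicator {y. B k y = S} x) \<partial>M)"
  proof (rule Bochner_Integration.integral_cong[OF refl])
    fix x assume "x \<in> space M"
    then have "B k x \<in> batches n" using batch_in k by blast
    then show "\<psi> x * avg (B k x) x = (\<Sum>S\<in>batches n. \<psi> x * avg S x * indicator {y. B k y = S} x)"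
      using finite_batches by (subst sum.remove[of _ "B k x"]) (auto intro!: sum.neutral simp: indicator_def)
  qed
  also have "\<dots> = (\<Sum>S\<in>batches n. \<integral>x. \<psi> x * avg S x * indicator {y. B k y = S} x \<partial>M)"
    by (intro Bochner_Integration.integral_sum int[of _ "\<lambda>T. T = _"])
  also have "\<dots> = (\<Sum>S\<in>batches n. \<integral>x. \<psi> x * avg S x * indicator {y. card (B k y) = card S} x / real (n choose card S) \<partial>M)"
    using integral_batch_indicator[OF k _ det_avg] by (intro sum.cong) auto
  also have "\<dots> = (\<integral>x. (\<Sum>S\<in>batches n. \<psi> x * avg S x * indicator {y. card (B k y) = card S} x / real (n choose card S)) \<partial>M)"
    by (intro Bochner_Integration.integral_sum[symmetric] integrable_divide_zero int[of _ "\<lambda>T. card T = _"])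
  also have "\<dots> = (\<integral>x. \<psi> x * ((\<Sum>i=1..n. a i x) / n) \<partial>M)"
  proof (rule Bochner_Integration.integral_cong[OF refl])
    fix x assume "x \<in> space M"
    define b where "b = card (B k x)"
    have Bx: "B k x \<subseteq> {1..n}" "B k x \<noteq> {}"
      using batch_in[OF k \<open>x \<in> space M\<close>] by (auto simp: batches_def)
    have "finite (B k x)" using Bx(1) by (rule finite_subset) simp
    then have b: "1 \<le> b" "b \<le> card {1..n}"
      using Bx card_mono[OF _ Bx(1)] card_gt_0_iff[of "B k x"] by (auto simp: b_def)
    have sub: "{S \<in> batches n. card S = b} = {S. S \<subseteq> {1..n} \<and> card S = b}"
      using b by (auto simp: batches_def)
    have "(\<Sum>S\<in>batches n. \<psi> x * avg S x * indicator {y. card (B k y) = card S} x / real (n choose card S))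
        = (\<Sum>S\<in>batches n. if card S = b then \<psi> x * ((\<Sum>i\<in>S. a i x) / b) / real (n choose b) else 0)"
      by (intro sum.cong refl) (auto simp: b_def avg_def)
    also have "\<dots> = (\<Sum>S | S \<subseteq> {1..n} \<and> card S = b. \<psi> x * ((\<Sum>i\<in>S. a i x) / b) / real (n choose b))"
      unfolding sub[symmetric] by (rule sum.inter_filter[OF finite_batches, symmetric])
    also have "\<dots> = \<psi> x * ((\<Sum>S | S \<subseteq> {1..n} \<and> card S = b. (\<Sum>i\<in>S. a i x) / b) / real (n choose b))"
      by (simp add: sum_distrib_left sum_divide_distrib)
    also have "\<dots> = \<psi> x * ((\<Sum>i=1..n. a i x) / n)"
      using average_over_subsets[OF _ b, of "\<lambda>i. a i x"] by simp
    finally show "(\<Sum>S\<in>batches n. \<psi> x * avg S x * indicator {y. card (B k y) = card S} x / real (n choose card S))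
        = \<psi> x * ((\<Sum>i=1..n. a i x) / n)" .
  qed
  finally show ?thesis by (simp add: avg_def)
qed

lemma integral_cond_exp_le:
  assumes \<psi>: "determined k (\<psi> :: 'a \<Rightarrow> real)" "\<And>x. x \<in> space M \<Longrightarrow> \<psi> x \<ge> 0"
    and f: "determined k' (f :: 'a \<Rightarrow> real)" and u: "determined k (u :: 'a \<Rightarrow> real)"
    and le: "AE x in M. real_cond_exp M (F k) f x \<le> u x"
  shows "(\<integral>x. \<psi> x * f x \<partial>M) \<le> (\<integral>x. \<psi> x * u x \<partial>M)"
proof -
  interpret finite_measure_subalgebra M "F k" by (rule finite_measure_subalgebra)
  have int: "integrable M (\<lambda>x. \<psi> x * f x)"
    by (rule determined_integrable[of "max k k'"])
      (intro determined_app2[where g = "(*)"] determined_mono[OF \<psi>(1)] determined_mono[OF f]; simp)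
  note cond = real_cond_exp_intg[OF int determined_measurable[OF \<psi>(1)] determined_measurable_M[OF f]]
  have "AE x in M. \<psi> x * real_cond_exp M (F k) f x \<le> \<psi> x * u x"
    using le AE_space by eventually_elim (auto intro: mult_left_mono \<psi>(2))
  moreover have "integrable M (\<lambda>x. \<psi> x * u x)"
    by (rule determined_integrable[of k]) (intro determined_app2[where g = "(*)"] \<psi>(1) u)
  ultimately show ?thesis
    unfolding cond(2)[symmetric] by (intro integral_mono_AE cond(1))
qed

end

section \<open>Expected gradient norms\<close>

lemma partial_risk:
  assumes "\<And>i. i \<in> {1..n} \<Longrightarrow> l i differentiable (at x)"
  shows "partial c (risk n l) x = (\<Sum>i=1..n. grad (l i) x $ c) / n"
proof -
  have "((\<lambda>t. l i (x + t *\<^sub>R axis c 1)) has_real_derivative grad (l i) x $ c) (at 0)" if "i \<in> {1..n}" for i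
  proof -
    have "((\<lambda>t. x + t *\<^sub>R axis c 1) has_derivative (\<lambda>t. t *\<^sub>R axis c 1)) (at (0::real))"
      by (auto intro!: derivative_eq_intros)
    moreover have "(l i has_derivative (\<lambda>u. u \<bullet> grad (l i) x)) (at (x + 0 *\<^sub>R axis c 1))"
      using GDERIV_grad[OF assms[OF that]] by (simp add: gderiv_def)
    ultimately have "((\<lambda>t. l i (x + t *\<^sub>R axis c 1)) has_derivative
        (\<lambda>t. (t *\<^sub>R axis c 1) \<bullet> grad (l i) x)) (at 0)"
      by (rule has_derivative_compose)
    then show ?thesis
      by (simp add: has_field_derivative_def inner_axis' mult.commute[of _ "grad (l i) x $ c"])
  qed
  then have "((\<lambda>t. risk n l (x + t *\<^sub>R axis c 1)) has_real_derivative
      (1 / real n) * (\<Sum>i=1..n. grad (l i) x $ c)) (at 0)"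
    unfolding risk_def by (intro DERIV_cmult DERIV_sum)
  then show ?thesis
    unfolding partial_def by (simp add: DERIV_imp_deriv)
qed

lemma differentiable_risk:
  assumes "\<And>i. i \<in> {1..n} \<Longrightarrow> l i differentiable (at x)"
  shows "risk n l differentiable (at x)"
  unfolding risk_def[abs_def] using assms by (intro differentiable_mult differentiable_sum) auto

context batch_process
begin

text \<open>Induction on \<open>k\<close> for the three quantities together. The moments carry index
  \<open>k - 1\<close>, since those of index \<open>k\<close> already contain the batch
  \<open>B k\<close>; so the denominator \<open>h\<close> of step \<open>k\<close> depends on the
  past only.\<close>

lemma adam_determined:
  assumes it: "\<And>x. x \<in> space M \<Longrightarrow>
      adam_iterates \<alpha> \<beta>1 \<beta>2 w1 v0 (\<lambda>k. batch_grad l (B k x) (w k x)) (\<lambda>k. m k x) (\<lambda>k. v k x) (\<lambda>k. w k x)"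
    and "k \<ge> 1"
  shows "determined k (w k)" "determined k (m (k - 1))" "determined k (v (k - 1))"
proof -
  have "w k x = w k y \<and> m (k - 1) x = m (k - 1) y \<and> v (k - 1) x = v (k - 1) y"
    if xy: "x \<in> space M" "y \<in> space M" and eq: "\<And>j. 1 \<le> j \<Longrightarrow> j < k \<Longrightarrow> B j x = B j y" for x y
    using \<open>k \<ge> 1\<close> eq
  proof (induction k rule: dec_induct)
    case base
    then show ?case using it[OF xy(1)] it[OF xy(2)] by (simp add: adam_iterates_def)
  next
    case (step k)
    then have IH: "w k x = w k y" "m (k - 1) x = m (k - 1) y" "v (k - 1) x = v (k - 1) y"
      and B: "B k x = B k y"
      by auto
    have upd: "m k u = \<beta>1 *\<^sub>R m (k - 1) u + (1 - \<beta>1) *\<^sub>R batch_grad l (B k u) (w k u)"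
        "v k u = \<beta>2 *\<^sub>R v (k - 1) u + (1 - \<beta>2) *\<^sub>R (batch_grad l (B k u) (w k u))\<^sup>2"
        "w (k + 1) u = w k u - \<alpha> *\<^sub>R (m k u * vec_powr (v k u) (-1/2))" if "u \<in> space M" for u
      using it[OF that] step(1) by (auto simp: adam_iterates_def)
    have "m k x = m k y" "v k x = v k y"
      unfolding upd(1,2)[OF xy(1)] upd(1,2)[OF xy(2)] IH B by (rule refl)+
    moreover from this have "w (k + 1) x = w (k + 1) y"
      unfolding upd(3)[OF xy(1)] upd(3)[OF xy(2)] IH by simp
    ultimately show ?case by simp
  qed
  then show "determined k (w k)" "determined k (m (k - 1))" "determined k (v (k - 1))"
    unfolding determined_def by blast+
qed

text \<open>The first claim is unbiasedness with the weight \<open>\<psi> * G\<close>. For the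
  second, \<open>g\<^sup>2 - G\<^sup>2\<close> is written as
  \<open>(g - G)\<^sup>2 + 2 * (G * g - G\<^sup>2)\<close>: the norm test controls the square, and
  the rest integrates to \<open>0\<close> by the first claim.\<close>

lemma expected_alignment_and_growth:
  fixes l :: "nat \<Rightarrow> real^'d \<Rightarrow> real" and w :: "nat \<Rightarrow> 'a \<Rightarrow> real^'d" and \<psi> :: "'a \<Rightarrow> real"
  defines "g k c x \<equiv> batch_grad l (B k x) (w k x) $ c"
    and "G k c x \<equiv> grad (risk n l) (w k x) $ c"
  assumes diff: "\<And>i x. i \<in> {1..n} \<Longrightarrow> l i differentiable (at x)"
    and k: "k \<ge> 1" and w: "determined k (w k)"
    and \<psi>: "determined k \<psi>" "\<And>x. x \<in> space M \<Longrightarrow> \<psi> x \<ge> 0"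
    and test: "AE x in M. real_cond_exp M (F k) (\<lambda>y. (g k c y - partial c (risk n l) (w k y))\<^sup>2) x
        \<le> \<eta>\<^sup>2 * (partial c (risk n l) (w k x))\<^sup>2"
  shows "(\<integral>x. \<psi> x * (G k c x * g k c x - (G k c x)\<^sup>2) \<partial>M) = 0"
    and "(\<integral>x. \<psi> x * ((g k c x)\<^sup>2 - (1 + \<eta>\<^sup>2) * (G k c x)\<^sup>2) \<partial>M) \<le> 0"
proof -
  have det_G: "determined k (G k c)"
    unfolding G_def by (rule determined_app[OF w])
  have "determined (Suc k) (\<lambda>x. batch_grad l (B k x) (w k x))"
    using determined_app2[OF determined_batch[OF k lessI] determined_mono[OF w], of "batch_grad l"] by simp
  then have det_g: "determined (Suc k) (g k c)"
    unfolding g_def by (rule determined_app)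
  have lift: "determined (Suc k) \<psi>" "determined (Suc k) (G k c)"
    using determined_mono[OF \<psi>(1), of "Suc k"] determined_mono[OF det_G, of "Suc k"] by simp_all
  have int: "integrable M (\<lambda>x. \<psi> x * H (G k c x) (g k c x))" for H :: "real \<Rightarrow> real \<Rightarrow> real"
    by (rule determined_integrable[of "Suc k"])
      (intro determined_app2[where g = "(*)"] determined_app2[where g = H] lift det_g)
  have G_eq: "G k c x = (\<Sum>i=1..n. grad (l i) (w k x) $ c) / n" for x
    unfolding G_def using partial_risk[OF diff] by (simp add: grad_def)
  have g_eq: "g k c x = (\<Sum>i\<in>B k x. grad (l i) (w k x) $ c) / card (B k x)" for x
    by (simp add: g_def batch_grad_def)
  have "(\<integral>x. (\<psi> x * G k c x) * g k c x \<partial>M) = (\<integral>x. (\<psi> x * G k c x) * G k c x \<partial>M)"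
    unfolding g_eq unfolding G_eq[of "_"]
    using batch_average_unbiased[OF k determined_app2[OF \<psi>(1) det_G, of "(*)"] determined_app[OF w, of "\<lambda>u. grad (l _) u $ c"]]
    unfolding G_eq .
  then have "(\<integral>x. \<psi> x * (G k c x * g k c x) \<partial>M) = (\<integral>x. \<psi> x * (G k c x)\<^sup>2 \<partial>M)"
    by (simp add: power2_eq_square mult.assoc)
  then show align: "(\<integral>x. \<psi> x * (G k c x * g k c x - (G k c x)\<^sup>2) \<partial>M) = 0"
    using int[of "\<lambda>a b. a * b"] int[of "\<lambda>a b. a\<^sup>2"] by (simp add: right_diff_distrib)
  have "(\<integral>x. \<psi> x * (g k c x - G k c x)\<^sup>2 \<partial>M) \<le> (\<integral>x. \<psi> x * (\<eta>\<^sup>2 * (G k c x)\<^sup>2) \<partial>M)"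
  proof (rule integral_cond_exp_le[OF \<psi>])
    show "determined (Suc k) (\<lambda>x. (g k c x - G k c x)\<^sup>2)"
      using determined_app2[OF det_g lift(2), of "\<lambda>a b. (a - b)\<^sup>2"] .
    show "determined k (\<lambda>x. \<eta>\<^sup>2 * (G k c x)\<^sup>2)"
      using determined_app[OF det_G, of "\<lambda>a. \<eta>\<^sup>2 * a\<^sup>2"] .
    show "AE x in M. real_cond_exp M (F k) (\<lambda>x. (g k c x - G k c x)\<^sup>2) x \<le> \<eta>\<^sup>2 * (G k c x)\<^sup>2"
      using test by (simp add: G_def grad_def)
  qed
  moreover have "(\<lambda>x. \<psi> x * ((g k c x)\<^sup>2 - (1 + \<eta>\<^sup>2) * (G k c x)\<^sup>2))
      = (\<lambda>x. \<psi> x * (g k c x - G k c x)\<^sup>2 - \<psi> x * (\<eta>\<^sup>2 * (G k c x)\<^sup>2)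
          + 2 * (\<psi> x * (G k c x * g k c x - (G k c x)\<^sup>2)))"
    by (rule ext) (simp add: power2_eq_square algebra_simps)
  ultimately show "(\<integral>x. \<psi> x * ((g k c x)\<^sup>2 - (1 + \<eta>\<^sup>2) * (G k c x)\<^sup>2) \<partial>M) \<le> 0"
    using int[of "\<lambda>a b. (b - a)\<^sup>2"] int[of "\<lambda>a b. \<eta>\<^sup>2 * a\<^sup>2"] int[of "\<lambda>a b. a * b - a\<^sup>2"] align
    by simp
qed

end

theorem theorem1:
  fixes l :: "nat \<Rightarrow> real^'d::finite \<Rightarrow> real" and n :: nat
    and L \<alpha> \<beta>1 \<beta>2 \<eta> :: real and w1 v0 :: "real^'d"
  assumes "n \<ge> 1"
    and "\<And>i. i \<in> {1..n} \<Longrightarrow> continuously_differentiable (l i)"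
    and "bdd_below (range (risk n l))"
    and "L > 0"
    and "\<And>x y. norm (grad (risk n l) x - grad (risk n l) y) \<le> L * norm (x - y)"
    and "\<alpha> > 0"
    and "\<And>i. v0 $ i > 0"
    and "\<eta> \<in> {0<..<1}"
    and "0 < \<beta>1"
    and "\<beta>1 \<le> sqrt \<beta>2 - 8 * (1 + \<eta>^2) * (1 - \<beta>2) / \<beta>2^2"
    and "\<beta>2 \<in> {0<..<1}"
  shows "\<exists>h \<in> soft_O (\<lambda>K. real K).
           \<forall>(M :: 'a measure) B w. adam_with_norm_test \<alpha> \<beta>1 \<beta>2 \<eta> n l w1 v0 M B w \<longrightarrow>
             (\<forall>K. (\<Sum>k=1..K. \<integral>x. norm (grad (risk n l) (w k x)) \<partial>M) \<le> h K)"
proof -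
  interpret adam_parameters \<beta>1 \<beta>2 \<eta>
    using assms(9-11) by unfold_locales auto
  define f where "f = risk n l"
  have diff: "l i differentiable (at x)" if "i \<in> {1..n}" for i x
    using assms(2)[OF that] by (simp add: continuously_differentiable_def)
  \<comment> \<open>A lower bound on the risk caps the total descent along every trajectory, which
    keeps the sum of the terms \<open>y\<close> linear in \<open>K\<close>.\<close>
  obtain fmin where fmin: "\<And>x. f x \<ge> fmin"
    using assms(3) by (auto simp: bdd_below_def f_def)
  have "f differentiable (at x)" for x
    unfolding f_def by (rule differentiable_risk[OF diff])
  from path_bound[OF this assms(5)[folded f_def] less_imp_le[OF assms(4)] fmin assms(6,7)]
  obtain C c2 c3 where C: "0 \<le> C" "0 \<le> c2" "0 \<le> c3"
    and bound: "\<And>g m v w K. adam_iterates \<alpha> \<beta>1 \<beta>2 w1 v0 g m v w \<Longrightarrow>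
      (\<Sum>k=1..K. \<Sum>i\<in>UNIV. \<bar>grad f (w k) $ i\<bar>) \<le> C * (1 + real K)
        - c2 * (\<Sum>k=1..K. \<Sum>i\<in>UNIV. (grad f (w k) $ i * g k $ i - (grad f (w k) $ i)\<^sup>2)
            / (sqrt \<beta>2 * sqrt (v (k - 1) $ i + 1)))
        + c3 * (\<Sum>k=1..K. \<Sum>i\<in>UNIV. ((g k $ i)\<^sup>2 - s * (grad f (w k) $ i)\<^sup>2)
            / (sqrt \<beta>2 * sqrt (v (k - 1) $ i + 1)))"
    by blast
  show ?thesis
  proof (intro bexI[of _ "\<lambda>K. C * (1 + real K)"] allI impI)
    \<comment> \<open>The logarithmic exponent \<open>0\<close> suffices.\<close>
    have "(\<lambda>K. C * (1 + real K)) \<in> O(\<lambda>K. real K * ln (real K) ^ 0)"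
    proof (rule bigoI)
      show "\<forall>\<^sub>F K in sequentially. norm (C * (1 + real K)) \<le> 2 * C * norm (real K * ln (real K) ^ 0)"
        using eventually_ge_at_top[of 1]
      proof eventually_elim
        case (elim K)
        then have "C * (1 + real K) \<le> C * (2 * real K)" using C by (intro mult_left_mono) auto
        then show ?case using C by (simp add: mult_ac)
      qed
    qed
    then show "(\<lambda>K. C * (1 + real K)) \<in> soft_O real" unfolding soft_O_def by blast
  next
    fix M :: "'a measure" and B w K
    assume run: "adam_with_norm_test \<alpha> \<beta>1 \<beta>2 \<eta> n l w1 v0 M B w"
    then obtain m v where it: "\<And>x. x \<in> space M \<Longrightarrow>
        adam_iterates \<alpha> \<beta>1 \<beta>2 w1 v0 (\<lambda>k. batch_grad l (B k x) (w k x)) (\<lambda>k. m k x) (\<lambda>k. v k x) (\<lambda>k. w k x)"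
      and M: "prob_space M" and sampling: "uniform_batch_sampling M n (w 1) B"
      and test: "coordinatewise_norm_test M \<eta> n l B w"
      unfolding adam_with_norm_test_def by blast
    interpret prob_space M by (rule M)
    interpret batch_process M n "w 1" w1 B
      using it sampling by unfold_locales (auto simp: adam_iterates_def)
    \<comment> \<open>The weight \<open>\<psi>\<close> is \<open>1 / h\<close>; \<open>D1\<close>
      and \<open>D2\<close> are the summands with coefficients \<open>c2\<close> and
      \<open>c3\<close> in \<open>path_bound\<close>.\<close>
    define g G \<psi> where "g k i x = batch_grad l (B k x) (w k x) $ i"
      and "G k i x = grad f (w k x) $ i"
      and "\<psi> k i x = 1 / (sqrt \<beta>2 * sqrt (v (k - 1) x $ i + 1))" for k i x
    define D1 D2 where "D1 k i x = \<psi> k i x * (G k i x * g k i x - (G k i x)\<^sup>2)"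
      and "D2 k i x = \<psi> k i x * ((g k i x)\<^sup>2 - s * (G k i x)\<^sup>2)" for k i x
    have det_w: "determined k (w k)" and det_v: "determined k (v (k - 1))" if "k \<ge> 1" for k
      using adam_determined[OF it that] by auto
    have \<psi>: "determined k (\<psi> k i)" if "k \<ge> 1" for k i
      unfolding \<psi>_def using determined_app[OF det_v[OF that]] .
    have \<psi>_nonneg: "\<psi> k i x \<ge> 0" if "x \<in> space M" for k i x
      using v_pos[OF assms(6,7) it[OF that], of "k - 1" i] beta2 by (simp add: \<psi>_def)
    have int: "integrable M (D1 k i)" "integrable M (D2 k i)" "integrable M (\<lambda>x. norm (grad f (w k x)))"
      "integrable M (\<lambda>x. \<bar>G k i x\<bar>)" if k: "k \<ge> 1" for k i
    proof -
      have 1: "determined (Suc k) (\<psi> k i)" "determined (Suc k) (w k)"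
        using determined_mono[OF \<psi>[OF k]] determined_mono[OF det_w[OF k]] by simp_all
      have gw: "determined (Suc k) (\<lambda>x. H (B k x) (w k x) :: real)" for H
        using determined_app2[OF determined_batch[OF k lessI] 1(2), of H] .
      have \<psi>gw: "integrable M (\<lambda>x. \<psi> k i x * H (B k x) (w k x))" for H
        by (rule determined_integrable) (rule determined_app2[OF 1(1) gw])
      show "integrable M (D1 k i)"
        using \<psi>gw[of "\<lambda>S u. grad f u $ i * batch_grad l S u $ i - (grad f u $ i)\<^sup>2"]
        unfolding D1_def g_def G_def .
      show "integrable M (D2 k i)"
        using \<psi>gw[of "\<lambda>S u. (batch_grad l S u $ i)\<^sup>2 - s * (grad f u $ i)\<^sup>2"]
        unfolding D2_def g_def G_def .
      show "integrable M (\<lambda>x. norm (grad f (w k x)))"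
        by (rule determined_integrable) (rule determined_app[OF 1(2)])
      show "integrable M (\<lambda>x. \<bar>G k i x\<bar>)"
        unfolding G_def by (rule determined_integrable) (rule determined_app[OF 1(2)])
    qed
    have D1: "(\<integral>x. D1 k i x \<partial>M) = 0" and D2: "(\<integral>x. D2 k i x \<partial>M) \<le> 0" if k: "k \<ge> 1" for k i
    proof -
      have "AE x in M. real_cond_exp M (F k) (\<lambda>y. (batch_grad l (B k y) (w k y) $ i - partial i (risk n l) (w k y))\<^sup>2) x
          \<le> \<eta>\<^sup>2 * (partial i (risk n l) (w k x))\<^sup>2"
        using test k by (simp add: coordinatewise_norm_test_def)
      note * = expected_alignment_and_growth
        [where l = l and w = w and k = k and c = i and \<psi> = "\<psi> k i" and \<eta> = \<eta>,
          OF diff k det_w[OF k] \<psi>[OF k] \<psi>_nonneg this]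
      show "(\<integral>x. D1 k i x \<partial>M) = 0" "(\<integral>x. D2 k i x \<partial>M) \<le> 0"
        using * unfolding D1_def D2_def g_def G_def f_def s_def by simp_all
    qed
    have "(\<Sum>k=1..K. \<integral>x. norm (grad f (w k x)) \<partial>M) \<le> (\<Sum>k=1..K. \<integral>x. (\<Sum>i\<in>UNIV. \<bar>G k i x\<bar>) \<partial>M)"
      unfolding G_def
      using int(3) int(4)[unfolded G_def]
      by (intro sum_mono integral_mono Bochner_Integration.integrable_sum norm_le_l1_cart) auto
    also have "\<dots> = (\<integral>x. (\<Sum>k=1..K. \<Sum>i\<in>UNIV. \<bar>G k i x\<bar>) \<partial>M)"
      using int(4) by (intro Bochner_Integration.integral_sum[symmetric] Bochner_Integration.integrable_sum) auto
    also have "\<dots> \<le> (\<integral>x. C * (1 + real K) - c2 * (\<Sum>k=1..K. \<Sum>i\<in>UNIV. D1 k i x)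
        + c3 * (\<Sum>k=1..K. \<Sum>i\<in>UNIV. D2 k i x) \<partial>M)"
    proof (rule integral_mono)
      show "integrable M (\<lambda>x. \<Sum>k=1..K. \<Sum>i\<in>UNIV. \<bar>G k i x\<bar>)"
        using int(4) by (intro Bochner_Integration.integrable_sum) auto
      show "integrable M (\<lambda>x. C * (1 + real K) - c2 * (\<Sum>k=1..K. \<Sum>i\<in>UNIV. D1 k i x)
          + c3 * (\<Sum>k=1..K. \<Sum>i\<in>UNIV. D2 k i x))"
        using int(1,2)
        by (intro Bochner_Integration.integrable_add Bochner_Integration.integrable_diff integrable_mult_right
            Bochner_Integration.integrable_sum integrable_const) auto
      fix x assume "x \<in> space M"
      then show "(\<Sum>k=1..K. \<Sum>i\<in>UNIV. \<bar>G k i x\<bar>) \<le> C * (1 + real K)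
          - c2 * (\<Sum>k=1..K. \<Sum>i\<in>UNIV. D1 k i x) + c3 * (\<Sum>k=1..K. \<Sum>i\<in>UNIV. D2 k i x)"
        using bound[OF it, of x K] by (simp add: G_def D1_def D2_def g_def \<psi>_def)
    qed
    also have "\<dots> = C * (1 + real K) - c2 * (\<Sum>k=1..K. \<Sum>i\<in>UNIV. \<integral>x. D1 k i x \<partial>M)
        + c3 * (\<Sum>k=1..K. \<Sum>i\<in>UNIV. \<integral>x. D2 k i x \<partial>M)"
    proof -
      have "integrable M (\<lambda>x. \<Sum>k=1..K. \<Sum>i\<in>UNIV. D1 k i x)" "integrable M (\<lambda>x. \<Sum>k=1..K. \<Sum>i\<in>UNIV. D2 k i x)"
        using int(1,2) by (auto intro!: Bochner_Integration.integrable_sum)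
      moreover have "(\<integral>x. (\<Sum>k=1..K. \<Sum>i\<in>UNIV. D k i x) \<partial>M) = (\<Sum>k=1..K. \<Sum>i\<in>UNIV. \<integral>x. D k i x \<partial>M)"
        if "\<And>k i. k \<ge> 1 \<Longrightarrow> integrable M (D k i)" for D :: "nat \<Rightarrow> 'd \<Rightarrow> 'a \<Rightarrow> real"
        using that by (subst Bochner_Integration.integral_sum)
          (auto intro!: sum.cong Bochner_Integration.integral_sum Bochner_Integration.integrable_sum)
      ultimately show ?thesis
        using int(1,2) by (simp add: prob_space)
    qed
    \<comment> \<open>The alignment terms have mean \<open>0\<close>; the growth terms have
      nonpositive mean and enter with the nonnegative coefficient \<open>c3\<close>.\<close>
    also have "\<dots> \<le> C * (1 + real K)"
    proof -
      have "(\<Sum>k=1..K. \<Sum>i\<in>UNIV. \<integral>x. D1 k i x \<partial>M) = 0" using D1 by simp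
      moreover have "(\<Sum>k=1..K. \<Sum>i\<in>UNIV. \<integral>x. D2 k i x \<partial>M) \<le> 0" using D2 by (intro sum_nonpos) auto
      ultimately show ?thesis using C by (simp add: mult_nonneg_nonpos)
    qed
    finally show "(\<Sum>k=1..K. \<integral>x. norm (grad (risk n l) (w k x)) \<partial>M) \<le> C * (1 + real K)"
      by (simp add: f_def)
  qed
qed

end
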